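(* In the setting described in the context, the conditional laws $\mathcal{L}(\mathcal{X}_n\mid\Sigma_n=k_n)$ converge weakly, as $n\to\infty$, to the probability measure on $\mathbb{R}^M$ which has density $f/\int f\,d\nu_0$ with respect to $\nu_0$.
   Context: Setting. Fix an integer $M\ge1$, numbers $\alpha_1,\dots,\alpha_M\in(0,1)$ with $\sum_{i=1}^M\alpha_i=1$, a number $\alpha\in(0,1)$, and probabilities $p_1,\dots,p_M\in(0,1)$. For every $n\ge1$, nonnegative integers $m_{1n},\dots,m_{Mn}$ (block sizes) with $\sum_i m_{in}=n$ are given, with $m_{in}/n\to\alpha_i$; also integers $0\le k_n\le n$ are given with $k_n/n\to\alpha$. For each $n$, $X_{1n},\dots,X_{Mn}$ are independent, $X_{in}$ being binomial with parameters $m_{in}$ and $p_i$ (the number of successes in block $i$ of a vector of $n$ independent Bernoulli variables, those in block $i$ having success probability $p_i$). Put $\Sigma_n:=\sum_{i=1}^M X_{in}$. Only $n$ so large that $0<k_n<n$ and $0<m_{in}<n$ for all $i$ are considered. For such $n$, $c_{1n},\dots,c_{Mn}\in(0,1)$ denote the unique solution of the system $$\frac{1-c_{in}}{c_{in}}\frac{p_i}{1-p_i}=\frac{1-c_{jn}}{c_{jn}}\frac{p_j}{1-p_j}\ \ \forall i,j\in\{1,\dots,M\},\qquad \sum_{i=1}^M c_{in}m_{in}=k_n.$$ One has $c_{in}\to c_i\in(0,1)$, where $c_i=\frac{p_i}{p_i+A(1-p_i)}$ and $A>0$ is the unique positive number with $\sum_{i=1}^M\frac{p_i\alpha_i}{p_i+A(1-p_i)}=\alpha$.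 Define the random vector $$\mathcal{X}_n:=\Bigl(\frac{X_{1n}-c_{1n}m_{1n}}{\sqrt n},\dots,\frac{X_{Mn}-c_{Mn}m_{Mn}}{\sqrt n}\Bigr).$$ Let $S_0:=\{z\in\mathbb{R}^M: z_1+\dots+z_M=0\}$, let $\nu_0(\cdot):=\lambda_0(\cdot\cap S_0)$ on the Borel sets of $\mathbb{R}^M$, where $\lambda_0$ is $(M-1)$-dimensional Lebesgue measure on $S_0$, and let $$f(z)=\mathbf{1}_{S_0}(z)\prod_{i=1}^M\exp\Bigl(-\frac{z_i^2}{2c_i(1-c_i)\alpha_i}\Bigr),\qquad z\in\mathbb{R}^M.$$ *)

theory Defs
  imports "HOL-Probability.Probability"
begin

text \<open>
  The number of blocks is the cardinality of a finite index type \<open>'i\<close>; block-indexed families are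
  functions on \<open>'i\<close>, and \<open>\<real>\<^sup>M\<close> is \<^typ>\<open>real^'i\<close>.
\<close>

section \<open>The conditioning parameters\<close>

text \<open>For a fixed \<open>n\<close>, \<open>m\<close> are the block sizes and \<open>k\<close> is the conditioned number of successes.\<close>

definition solves_tilt_system :: "('i::finite \<Rightarrow> real) \<Rightarrow> ('i \<Rightarrow> nat) \<Rightarrow> nat \<Rightarrow> ('i \<Rightarrow> real) \<Rightarrow> bool" where
  "solves_tilt_system p m k c \<longleftrightarrow>
     (\<forall>i. 0 < c i \<and> c i < 1) \<and>
     (\<forall>i j. (1 - c i) / c i * (p i / (1 - p i)) = (1 - c j) / c j * (p j / (1 - p j))) \<and>
     (\<Sum>i\<in>UNIV. c i * real (m i)) = real k"

definition tilted_prob :: "('i::finite \<Rightarrow> real) \<Rightarrow> ('i \<Rightarrow> nat) \<Rightarrow> nat \<Rightarrow> 'i \<Rightarrow> real" where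
  "tilted_prob p m k = (THE c. solves_tilt_system p m k c)"

definition tilt_const :: "('i::finite \<Rightarrow> real) \<Rightarrow> ('i \<Rightarrow> real) \<Rightarrow> real \<Rightarrow> real" where
  "tilt_const p a \<alpha> = (THE A. A > 0 \<and> (\<Sum>i\<in>UNIV. p i * a i / (p i + A * (1 - p i))) = \<alpha>)"

definition limit_prob :: "('i::finite \<Rightarrow> real) \<Rightarrow> ('i \<Rightarrow> real) \<Rightarrow> real \<Rightarrow> 'i \<Rightarrow> real" where
  "limit_prob p a \<alpha> i = p i / (p i + tilt_const p a \<alpha> * (1 - p i))"

lemma tilt_const_ex1:
  fixes p a :: "'i::finite \<Rightarrow> real"
  assumes p: "\<And>i. 0 < p i \<and> p i < 1" and a: "\<And>i. 0 < a i"
    and \<alpha>: "0 < \<alpha>" "\<alpha> < (\<Sum>i\<in>UNIV. a i)"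
  shows "\<exists>!A. A > 0 \<and> (\<Sum>i\<in>UNIV. p i * a i / (p i + A * (1 - p i))) = \<alpha>"
proof -
  define g where "g A = (\<Sum>i\<in>UNIV. p i * a i / (p i + A * (1 - p i)))" for A
  have pos: "p i + A * (1 - p i) > 0" if "A \<ge> 0" for A i
    using p[of i] that by (simp add: add_pos_nonneg)
  have mono: "g B < g A" if "0 \<le> A" "A < B" for A B
    unfolding g_def
  proof (rule sum_strict_mono)
    fix i
    show "p i * a i / (p i + B * (1 - p i)) < p i * a i / (p i + A * (1 - p i))"
      using p[of i] a[of i] pos[of A i] pos[of B i] that
      by (intro divide_strict_left_mono mult_pos_pos) auto
  qed auto
  have g0: "g 0 = (\<Sum>i\<in>UNIV. a i)"
    unfolding g_def by (intro sum.cong) (use p in \<open>auto simp: less_imp_neq[symmetric]\<close>)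
  have "(g \<longlongrightarrow> (\<Sum>i\<in>(UNIV::'i set). 0)) at_top"
    unfolding g_def
  proof (intro tendsto_sum)
    fix i
    have "filterlim (\<lambda>A. p i + A * (1 - p i)) at_top at_top"
      using p[of i] by (intro filterlim_tendsto_add_at_top[OF tendsto_const]
          filterlim_at_top_mult_tendsto_pos[OF tendsto_const _ filterlim_ident]) auto
    then show "((\<lambda>A. p i * a i / (p i + A * (1 - p i))) \<longlongrightarrow> 0) at_top"
      by (intro real_tendsto_divide_at_top[OF tendsto_const])
  qed
  then have "eventually (\<lambda>A. g A < \<alpha>) at_top"
    using \<alpha> by (intro order_tendstoD(2)[of g 0]) auto
  with eventually_gt_at_top[of 0] have "eventually (\<lambda>A. 0 < A \<and> g A < \<alpha>) at_top"
    by eventually_elim auto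
  then obtain B where B: "0 < B" "g B < \<alpha>"
    using eventually_happens'[OF trivial_limit_at_top_linorder] by blast
  have cont: "continuous_on {0..B} g"
    unfolding g_def by (intro continuous_intros) (use pos in \<open>auto simp: less_imp_neq[symmetric]\<close>)
  obtain A where A: "0 \<le> A" "A \<le> B" "g A = \<alpha>"
    using IVT2'[of g B \<alpha> 0] B \<alpha> g0 cont by auto
  then have "A > 0" using g0 \<alpha> by (cases "A = 0") auto
  moreover have "A' = A" if "A' > 0" "g A' = \<alpha>" for A'
    using mono[of A A'] mono[of A' A] that A \<open>A > 0\<close> by (cases A A' rule: linorder_cases) auto
  ultimately show ?thesis
    unfolding g_def[symmetric] using A(3) by blast
qed

lemma tilted_prob_ex1:
  fixes p :: "'i::finite \<Rightarrow> real"
  assumes p: "\<And>i. 0 < p i \<and> p i < 1" and m: "\<And>i. 0 < m i"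
    and k: "0 < k" "k < (\<Sum>i\<in>UNIV. m i)"
  shows "\<exists>!c. solves_tilt_system p m k c"
proof -
  have "real k < (\<Sum>i\<in>UNIV. real (m i))"
    using k by (metis of_nat_less_iff of_nat_sum)
  then have ex1: "\<exists>!A. A > 0 \<and> (\<Sum>i\<in>UNIV. p i * real (m i) / (p i + A * (1 - p i))) = real k"
    using p m k by (intro tilt_const_ex1) auto
  then obtain A where A: "A > 0" "(\<Sum>i\<in>UNIV. p i * real (m i) / (p i + A * (1 - p i))) = real k"
    by auto
  define c where "c i = p i / (p i + A * (1 - p i))" for i
  have pos: "p i + A * (1 - p i) > 0" for i
    using p[of i] A by (simp add: add_pos_pos)
  have odds: "(1 - c i) / c i * (p i / (1 - p i)) = A" for i
  proof -
    have "1 - c i = A * (1 - p i) / (p i + A * (1 - p i))"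
      using pos[of i] by (simp add: c_def diff_divide_eq_iff)
    then show ?thesis
      using p[of i] pos[of i] by (simp add: c_def)
  qed
  have "solves_tilt_system p m k c"
    unfolding solves_tilt_system_def odds
    using p pos A by (auto simp: c_def divide_simps)
  moreover have "d = c" if d: "solves_tilt_system p m k d" for d
  proof -
    have d01: "0 < d i \<and> d i < 1" for i
      using d by (auto simp: solves_tilt_system_def)
    define D where "D = (1 - d undefined) / d undefined * (p undefined / (1 - p undefined))"
    have D: "(1 - d i) / d i * (p i / (1 - p i)) = D" for i
      using d unfolding solves_tilt_system_def D_def by blast
    have Dpos: "D > 0"
      using d01[of undefined] p[of undefined] unfolding D_def by auto
    have di: "d i = p i / (p i + D * (1 - p i))" for i
    proof -
      have "p i + D * (1 - p i) > 0"
        using p[of i] Dpos by (simp add: add_pos_pos)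
      moreover have "(1 - d i) * p i = D * d i * (1 - p i)"
        using D[of i] d01[of i] p[of i] by (simp add: field_simps)
      ultimately show ?thesis
        by (simp add: field_simps)
    qed
    have "(\<Sum>i\<in>UNIV. p i * real (m i) / (p i + D * (1 - p i))) = real k"
      using d by (simp add: solves_tilt_system_def di)
    then have "D = A" using ex1 A Dpos by blast
    then show ?thesis by (simp add: fun_eq_iff di c_def)
  qed
  ultimately show ?thesis by blast
qed

section \<open>Lebesgue measure on a linear subspace\<close>

definition orthonormal_basis_of :: "'a::euclidean_space set \<Rightarrow> 'a set \<Rightarrow> bool" where
  "orthonormal_basis_of S B \<longleftrightarrow> pairwise orthogonal B \<and> (\<forall>b\<in>B. norm b = 1) \<and> span B = S"

lemma orthonormal_basis_of_exists:
  assumes "subspace S"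
  shows "\<exists>B. orthonormal_basis_of S B"
  using orthonormal_basis_subspace[OF assms] unfolding orthonormal_basis_of_def by metis

text \<open>
  The \<open>dim S\<close>-dimensional Lebesgue measure on \<open>S\<close>, as a measure with space \<open>S\<close>, is built in the same
  way as \<^const>\<open>lborel\<close>, with an orthonormal basis of \<open>S\<close> in place of \<^const>\<open>Basis\<close>. As Lebesgue
  measure is invariant under isometries, it does not depend on the basis that is chosen.
\<close>

definition subspace_lborel :: "'a::euclidean_space set \<Rightarrow> 'a measure" where
  "subspace_lborel S =
     (let B = (SOME B. orthonormal_basis_of S B)
      in distr (\<Pi>\<^sub>M b\<in>B. (lborel :: real measure)) (restrict_space borel S) (\<lambda>x. \<Sum>b\<in>B. x b *\<^sub>R b))"

definition zero_sum_space :: "(real^'i::finite) set" where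
  "zero_sum_space = {z. (\<Sum>i\<in>UNIV. z $ i) = 0}"

text \<open>Pushing forward along the inclusion gives \<open>A \<mapsto> \<lambda>\<^sub>0 (A \<inter> S\<^sub>0)\<close> on the Borel sets.\<close>

definition nu0 :: "(real^'i::finite) measure" where
  "nu0 = distr (subspace_lborel zero_sum_space) borel (\<lambda>z. z)"

lemma subspace_zero_sum_space: "subspace (zero_sum_space :: (real^'i::finite) set)"
  by (auto simp: subspace_def zero_sum_space_def sum.distrib simp flip: sum_distrib_left)

lemma space_subspace_lborel: "space (subspace_lborel S) = S"
  and sets_subspace_lborel: "sets (subspace_lborel S) = sets (restrict_space borel S)"
  by (simp_all add: subspace_lborel_def Let_def space_restrict_space)

lemma emeasure_nu0:
  assumes "A \<in> sets borel"
  shows "emeasure nu0 A = emeasure (subspace_lborel zero_sum_space) (A \<inter> zero_sum_space)"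
proof -
  have "(\<lambda>z. z) \<in> subspace_lborel zero_sum_space \<rightarrow>\<^sub>M (borel :: (real^'i) measure)"
    by (subst measurable_cong_sets[OF sets_subspace_lborel refl]) (rule measurable_restrict_space1, simp)
  then show ?thesis
    using assms unfolding nu0_def by (subst emeasure_distr) (simp_all add: space_subspace_lborel)
qed

section \<open>The conditional laws and their limit\<close>

definition normalized_vec ::
  "nat \<Rightarrow> ('i \<Rightarrow> nat) \<Rightarrow> ('i::finite \<Rightarrow> real) \<Rightarrow> ('i \<Rightarrow> 'a \<Rightarrow> nat) \<Rightarrow> 'a \<Rightarrow> real^'i" where
  "normalized_vec n m c X \<omega> = (\<chi> i. (real (X i \<omega>) - c i * real (m i)) / sqrt (real n))"

text \<open>\<^const>\<open>uniform_measure\<close> \<open>M E\<close> is the conditional probability \<open>A \<mapsto> P(A \<inter> E) / P(E)\<close>.\<close>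

definition conditional_law ::
  "'a measure \<Rightarrow> ('a \<Rightarrow> 'b::topological_space) \<Rightarrow> ('a \<Rightarrow> bool) \<Rightarrow> 'b measure" where
  "conditional_law M Y E = distr (uniform_measure M {\<omega> \<in> space M. E \<omega>}) borel Y"

definition limit_weight :: "('i::finite \<Rightarrow> real) \<Rightarrow> ('i \<Rightarrow> real) \<Rightarrow> real^'i \<Rightarrow> real" where
  "limit_weight c a z =
     indicator zero_sum_space z * (\<Prod>i\<in>UNIV. exp (- ((z $ i)\<^sup>2 / (2 * c i * (1 - c i) * a i))))"

definition limit_law :: "('i::finite \<Rightarrow> real) \<Rightarrow> ('i \<Rightarrow> real) \<Rightarrow> (real^'i) measure" where
  "limit_law c a = density nu0 (\<lambda>z. ennreal (limit_weight c a z / (\<integral>y. limit_weight c a y \<partial>nu0)))"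

text \<open>The library's \<^const>\<open>weak_conv_m\<close> only covers measures on the real line.\<close>

definition converges_weakly :: "(nat \<Rightarrow> 'b::topological_space measure) \<Rightarrow> 'b measure \<Rightarrow> bool" where
  "converges_weakly \<mu> \<nu> \<longleftrightarrow>
     (\<forall>g :: 'b \<Rightarrow> real. continuous_on UNIV g \<longrightarrow> bounded (range g) \<longrightarrow>
        (\<lambda>n. \<integral>x. g x \<partial>\<mu> n) \<longlonglongrightarrow> (\<integral>x. g x \<partial>\<nu>))"

end

theory Submission
  imports Defs
begin

text \<open>
  On the event that the counts sum to \<open>k\<close>, replacing \<open>p\<close> by the tilted probabilities multiplies the
  probability of every count vector by the same constant, so the conditional law is given by products
  of binomial weights with means \<open>c i * m i\<close> adding up to \<open>k\<close>. Each weight is divided by its value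
  at \<open>\<lfloor>c i * m i\<rfloor>\<close>: no Stirling formula is needed, since the conditional law is normalised
  anyway, and both the local Gaussian limit and a Gaussian upper bound follow from the quotients of
  consecutive binomial weights. Summing over the lattice points of the hyperplane is integrating a
  step function in all coordinates but one, so that dominated convergence gives the limit in these
  coordinates. Finally, Lebesgue measure in these coordinates and \<open>\<lambda>\<^sub>0\<close> are both invariant under
  translations of the hyperplane, hence proportional, and the constant cancels in the quotient.
\<close>

section \<open>Binomial weights near the mean\<close>

text \<open>The weights are estimated in two ways that differ in nature. The pointwise limit needs
  the exact variance \<open>m * c * (1 - c)\<close>, but only for deviations of order sqrt n. The
  majorant for dominated convergence must hold at every lattice point, but may have the larger
  variance \<open>m\<close>, for which one-sided logarithm inequalities suffice. Since each block
  size is at most n, this majorant becomes one fixed Gaussian in the rescaled coordinates. On the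
  hyperplane all coordinates but \<open>i0\<close> are rounded; the remaining one is forced by the
  sum and inherits its error from the others. Numerator and denominator of a conditional expectation
  are lattice sums of the same shape, so neither the volume of a cell nor the probability of the
  conditioning event is ever estimated. For the same reason the comparison with
  \<open>\<lambda>\<^sub>0\<close> is an identity between products of integrals in which the even
  weight is itself a test function: no Jacobian of the chart is computed.\<close>

definition binom_weight :: "real \<Rightarrow> nat \<Rightarrow> int \<Rightarrow> real" where
  "binom_weight c m x =
     (if 0 \<le> x \<and> x \<le> int m then real (m choose nat x) * (c / (1 - c)) ^ nat x else 0)"

text \<open>\<open>binom_weight\<close> is the binomial probability up to the factor
  \<open>(1 - c) ^ m\<close>, which cancels in this quotient.\<close>

definition binom_ratio :: "real \<Rightarrow> nat \<Rightarrow> int \<Rightarrow> real" where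
  "binom_ratio c m x = binom_weight c m x / binom_weight c m \<lfloor>c * real m\<rfloor>"

lemma binom_weight_pos:
  assumes "0 < c" "c < 1" "0 \<le> x" "x \<le> int m"
  shows "binom_weight c m x > 0"
  using assms by (simp add: binom_weight_def nat_le_iff)

lemma binom_weight_nonneg:
  assumes "0 < c" "c < 1"
  shows "binom_weight c m x \<ge> 0"
  using assms by (simp add: binom_weight_def)

lemma floor_mean_bounds:
  assumes "0 < c" "c < 1"
  shows "0 \<le> \<lfloor>c * real m\<rfloor>" "\<lfloor>c * real m\<rfloor> \<le> int m"
proof -
  show "0 \<le> \<lfloor>c * real m\<rfloor>" using assms by simp
  have "c * real m \<le> real m" using assms by (simp add: mult_left_le_one_le)
  then show "\<lfloor>c * real m\<rfloor> \<le> int m" by linarith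
qed

lemma binom_ratio_nonneg:
  assumes "0 < c" "c < 1"
  shows "binom_ratio c m x \<ge> 0"
  using binom_weight_nonneg[OF assms] by (simp add: binom_ratio_def)

text \<open>An integer point of the hyperplane may have coordinates that are not possible counts,
  since one of them is forced by the sum; zero weight there keeps the lattice sums finite.\<close>

lemma binom_ratio_eq_0:
  "x < 0 \<or> int m < x \<Longrightarrow> binom_ratio c m x = 0"
  by (auto simp: binom_ratio_def binom_weight_def)

lemma binom_ratio_eq_exp:
  assumes "0 < c" "c < 1" "0 \<le> x" "x \<le> int m"
  shows "binom_ratio c m x = exp (ln (binom_weight c m x) - ln (binom_weight c m \<lfloor>c * real m\<rfloor>))"
  using binom_weight_pos[OF assms] binom_weight_pos[OF assms(1,2) floor_mean_bounds[OF assms(1,2)], of m]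
  by (simp add: binom_ratio_def exp_diff)

text \<open>The quotient of consecutive weights is \<open>(m - x) * c / ((x + 1) * (1 - c))\<close>.
  With \<open>m - x = m * (1 - c) - y\<close> and \<open>x + 1 = c * m + y + 1\<close>, division by
  the leading terms gives arguments near 1, suited both to one-sided bounds and to a Taylor
  expansion of the logarithm.\<close>

lemma ln_binom_weight_step:
  assumes c: "0 < c" "c < 1" and x: "0 \<le> x" "x < int m"
  defines "y \<equiv> real_of_int x - c * real m"
  shows "ln (binom_weight c m (x + 1)) - ln (binom_weight c m x) =
           ln (1 - y / (real m * (1 - c))) - ln (1 + (y + 1) / (c * real m))"
    and "1 - y / (real m * (1 - c)) > 0" and "1 + (y + 1) / (c * real m) > 0"
proof -
  define j where "j = nat x"
  have j: "x = int j" "j < m" using x by (auto simp: j_def)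
  have m: "real m > 0" using j by simp
  have e1: "1 - y / (real m * (1 - c)) = (real m - real j) / (real m * (1 - c))"
    using c m by (simp add: y_def j field_simps)
  have e2: "1 + (y + 1) / (c * real m) = (real j + 1) / (c * real m)"
    using c m by (simp add: y_def j field_simps)
  show p1: "1 - y / (real m * (1 - c)) > 0" unfolding e1 using c j m by simp
  show p2: "1 + (y + 1) / (c * real m) > 0" unfolding e2 using c j m by (simp add: add_pos_nonneg)
  have ch: "real (Suc j) * real (m choose Suc j) = (real m - real j) * real (m choose j)"
  proof -
    have "Suc j * (m choose Suc j) = m * ((m - 1) choose j)"
      using Suc_times_binomial[of j "m - 1"] j(2) by simp
    also have "\<dots> = (m - j) * (m choose j)"
      by (rule binomial_absorb_comp[symmetric])
    finally show ?thesis
      using j(2) by (metis of_nat_diff less_imp_le_nat of_nat_mult)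
  qed
  have "binom_weight c m (x + 1) = real (m choose Suc j) * (c / (1 - c)) ^ Suc j"
    using j by (simp add: binom_weight_def nat_add_distrib)
  also have "real (m choose Suc j) = (real m - real j) * real (m choose j) / real (Suc j)"
    using ch by (simp add: field_simps)
  also have "\<dots> * (c / (1 - c)) ^ Suc j = real (m choose j) * (c / (1 - c)) ^ j *
      ((real m - real j) * c / ((real j + 1) * (1 - c)))"
    by (simp add: mult_ac add_ac)
  also have "(real m - real j) * c / ((real j + 1) * (1 - c)) =
      ((real m - real j) / (real m * (1 - c))) / ((real j + 1) / (c * real m))"
    using c m by simp
  also have "real (m choose j) * (c / (1 - c)) ^ j = binom_weight c m x"
    using j by (simp add: binom_weight_def)
  finally have "binom_weight c m (x + 1) =
      binom_weight c m x * ((1 - y / (real m * (1 - c))) / (1 + (y + 1) / (c * real m)))"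
    unfolding e1 e2 .
  then show "ln (binom_weight c m (x + 1)) - ln (binom_weight c m x) =
           ln (1 - y / (real m * (1 - c))) - ln (1 + (y + 1) / (c * real m))"
    using p1 p2 binom_weight_pos[of c x m] c x by (simp add: ln_mult ln_div)
qed

text \<open>Moving away from the mean, the logarithm of the weight drops per step by at least |y| /
  m up to an error of order 1 / m, because \<open>1 / c\<close> and \<open>1 / (1 - c)\<close> are
  at least 1. So after adding the parabola with variance \<open>m\<close> it grows by at most
  \<open>K / m\<close> per step, and there are at most \<open>m\<close> steps. The value of the
  parabola at the rounded mean costs the remaining 1/2 in the exponent.\<close>

lemma binom_ratio_le:
  assumes c: "0 < c" "c < 1" and m: "m > 0"
  shows "binom_ratio c m x \<le> exp (1 / (1 - c) + 1) * exp (- ((real_of_int x - c * real m)\<^sup>2 / (2 * real m)))"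
proof (cases "0 \<le> x \<and> x \<le> int m")
  case False
  then show ?thesis by (subst binom_ratio_eq_0) auto
next
  case True
  define x0 where "x0 = \<lfloor>c * real m\<rfloor>"
  have x0: "0 \<le> x0" "x0 \<le> int m" using floor_mean_bounds[OF c, of m] by (auto simp: x0_def)
  have x0': "real_of_int x0 \<le> c * real m" "c * real m < real_of_int x0 + 1" by (auto simp: x0_def)
  define V where "V x = ln (binom_weight c m x) + (real_of_int x - c * real m)\<^sup>2 / (2 * real m)" for x
  have sq: "(real_of_int (x + 1) - c * real m)\<^sup>2 / (2 * real m) - (real_of_int x - c * real m)\<^sup>2 / (2 * real m)
     = (real_of_int x - c * real m) / real m + 1 / (2 * real m)" for x
    using m by (simp add: field_simps power2_eq_square)
  \<comment> \<open>The term \<open>1 / (1 - c)\<close> covers upward steps that start slightly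
    below the mean, where only \<open>y > -1\<close> is known; 1/2 is the second-order part of the
    increment of the parabola.\<close>
  define K where "K = 1 / (1 - c) + 1 / 2"
  have K: "K > 0" "K \<ge> 1/2" using c by (auto simp: K_def add_pos_pos)
  \<comment> \<open>On this side the logarithm involving \<open>c * real m\<close> is nonnegative
    and is dropped; \<open>ln t \<le> t - 1\<close> treats the other.\<close>
  have up: "V (x + 1) - V x \<le> K / real m" if x: "x0 \<le> x" "x < int m" for x
  proof -
    define y where "y = real_of_int x - c * real m"
    have y: "y > -1" using x x0' by (simp add: y_def)
    note s = ln_binom_weight_step[OF c, of x m, folded y_def]
    have xx: "0 \<le> x" using x x0 by simp
    have "ln (1 + (y + 1) / (c * real m)) \<ge> 0" using y c m by (intro ln_ge_zero) auto
    moreover have "ln (1 - y / (real m * (1 - c))) \<le> - (y / (real m * (1 - c)))"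
      using ln_le_minus_one[OF s(2)[OF xx x(2)]] by simp
    moreover have "- (y / (real m * (1 - c))) + y / real m \<le> 1 / ((1 - c) * real m)"
    proof -
      have "- y / (1 - c) + y \<le> 1 / (1 - c)"
      proof -
        have "c * y \<ge> - 1"
        proof (cases "y \<ge> 0")
          case False
          then have "c * (-y) \<le> 1 * 1" using c y by (intro mult_mono) auto
          then show ?thesis by simp
        qed (use c in \<open>auto intro: order_trans[of _ 0]\<close>)
        then have "1 / (1 - c) - (- y / (1 - c) + y) \<ge> 0" using c by (simp add: field_simps)
        then show ?thesis by simp
      qed
      then have "(- y / (1 - c) + y) / real m \<le> 1 / (1 - c) / real m"
        by (intro divide_right_mono) auto
      then show ?thesis by (simp add: diff_divide_distrib mult.commute)
    qed
    ultimately have "ln (binom_weight c m (x + 1)) - ln (binom_weight c m x) + y / real m \<le> 1 / ((1 - c) * real m)"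
      using s(1)[OF xx x(2)] by linarith
    then show ?thesis using sq[of x] by (simp add: V_def y_def K_def add_divide_distrib)
  qed
  \<comment> \<open>Here the roles are exchanged: the logarithm involving \<open>1 - c\<close> is
    dropped, and \<open>y + 1 \<le> 0\<close> permits replacing the denominator
    \<open>c * real m\<close> by \<open>real m\<close>.\<close>
  have down: "V x - V (x + 1) \<le> K / real m" if x: "0 \<le> x" "x + 1 \<le> x0" for x
  proof -
    define y where "y = real_of_int x - c * real m"
    have y: "y + 1 \<le> 0" using x x0' by (simp add: y_def)
    have xx: "x < int m" using x x0 by simp
    note s = ln_binom_weight_step[OF c, of x m, folded y_def]
    have "ln (1 - y / (real m * (1 - c))) \<ge> 0" using y c m by (intro ln_ge_zero) (auto simp: divide_nonpos_pos)
    moreover have "ln (1 + (y + 1) / (c * real m)) \<le> (y + 1) / (c * real m)"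
      using ln_le_minus_one[OF s(3)[OF x(1) xx]] by simp
    moreover have "(y + 1) / (c * real m) \<le> (y + 1) / real m"
      using y c m by (intro divide_left_mono_neg) (auto simp: mult_left_le_one_le)
    ultimately have "ln (binom_weight c m x) - ln (binom_weight c m (x + 1)) \<le> (y + 1) / real m"
      using s(1)[OF x(1) xx] by linarith
    then have "V x - V (x + 1) \<le> (y + 1) / real m - (y / real m + 1 / (2 * real m))"
      using sq[of x] by (simp add: V_def y_def)
    also have "\<dots> = (1/2) / real m" using m by (simp add: field_simps)
    also have "\<dots> \<le> K / real m" using K m by (intro divide_right_mono) auto
    finally show ?thesis .
  qed
  have "V x \<le> V x0 + K / real m * \<bar>real_of_int x - real_of_int x0\<bar>"
  proof (cases "x0 \<le> x")
    case True
    have "x \<le> int m \<longrightarrow> V x \<le> V x0 + K / real m * \<bar>real_of_int x - real_of_int x0\<bar>"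
      using True
    proof (induction x rule: int_ge_induct)
      case (step x)
      then show ?case using up[of x] by (auto simp: algebra_simps add_divide_distrib)
    qed auto
    then show ?thesis using \<open>0 \<le> x \<and> x \<le> int m\<close> by auto
  next
    case False
    then have "x \<le> x0" by simp
    then have "0 \<le> x \<longrightarrow> V x \<le> V x0 + K / real m * \<bar>real_of_int x - real_of_int x0\<bar>"
    proof (induction x rule: int_le_induct)
      case (step x)
      then show ?case using down[of "x - 1"] by (auto simp: algebra_simps add_divide_distrib diff_divide_distrib)
    qed auto
    then show ?thesis using \<open>0 \<le> x \<and> x \<le> int m\<close> by auto
  qed
  also have "K / real m * \<bar>real_of_int x - real_of_int x0\<bar> \<le> K / real m * real m"
    using True x0 K by (intro mult_left_mono) auto
  also have "K / real m * real m = K" using m by simp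
  finally have 1: "V x \<le> V x0 + K" by simp
  have "(real_of_int x0 - c * real m)\<^sup>2 \<le> 1"
    using x0' by (simp add: abs_square_le_1)
  then have "(real_of_int x0 - c * real m)\<^sup>2 / (2 * real m) \<le> 1 / 2"
    using m by (simp add: field_simps)
  then have "ln (binom_weight c m x) - ln (binom_weight c m x0) \<le>
      1 / (1 - c) + 1 - (real_of_int x - c * real m)\<^sup>2 / (2 * real m)"
    using 1 unfolding V_def K_def by linarith
  then show ?thesis
    using True c by (simp add: binom_ratio_eq_exp x0_def flip: exp_add)
qed


section \<open>The local Gaussian limit of the binomial weights\<close>

lemma abs_diff_le_of_int_steps:
  fixes D :: "int \<Rightarrow> real"
  assumes step: "\<And>j. u \<le> j \<Longrightarrow> j < v \<Longrightarrow> \<bar>D (j + 1) - D j\<bar> \<le> e" and "u \<le> v"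
  shows "\<bar>D v - D u\<bar> \<le> e * real_of_int (v - u)"
proof -
  have "w \<le> v \<longrightarrow> \<bar>D w - D u\<bar> \<le> e * real_of_int (w - u)" if "u \<le> w" for w
    using that
  proof (induction w rule: int_ge_induct)
    case (step i)
    show ?case
    proof
      assume "i + 1 \<le> v"
      then show "\<bar>D (i + 1) - D u\<bar> \<le> e * real_of_int (i + 1 - u)"
        using step assms(1)[of i] by (auto simp: algebra_simps)
    qed
  qed auto
  then show ?thesis using \<open>u \<le> v\<close> by blast
qed

text \<open>In the application \<open>s\<close> is sqrt n, \<open>R\<close> bounds the rescaled
  deviation, and \<open>\<kappa>\<close> bounds \<open>c * m / n\<close> and
  \<open>(1 - c) * m / n\<close> from below. Between the rounded mean and \<open>x\<close> there are
  at most \<open>2 * R * s\<close> steps, each with an error of order \<open>1 / s\<^sup>2\<close>.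
  The condition \<open>2 * R \<le> \<kappa> * s\<close> keeps the arguments within 1/2 of 1, where
  the quadratic remainder bound for the logarithm holds; \<open>1 \<le> R * s\<close> puts the
  rounded mean into the window. The last term of the bound pays for rounding the mean.\<close>

lemma ln_binom_weight_approx:
  assumes c: "0 < c" "c < 1" and \<kappa>: "0 < \<kappa>" "\<kappa> * s\<^sup>2 \<le> c * real m" "\<kappa> * s\<^sup>2 \<le> real m * (1 - c)"
    and s: "1 \<le> R * s" "0 < s" "2 * R \<le> \<kappa> * s"
    and x: "\<bar>real_of_int x - c * real m\<bar> \<le> R * s"
  shows "0 \<le> x" "x \<le> int m"
    "\<bar>ln (binom_weight c m x) - ln (binom_weight c m \<lfloor>c * real m\<rfloor>)
        + (real_of_int x - c * real m)\<^sup>2 / (2 * (real m * c * (1 - c)))\<bar>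
      \<le> 2 * R * (1 / \<kappa> + 4 * R\<^sup>2 / \<kappa>\<^sup>2) / s + 1 / (\<kappa> * s\<^sup>2)"
proof -
  define x0 where "x0 = \<lfloor>c * real m\<rfloor>"
  have x0: "\<bar>real_of_int x0 - c * real m\<bar> \<le> 1" unfolding x0_def by linarith
  have Rpos: "0 < R" using s by (smt (verit) mult_nonpos_nonneg)
  have Rs: "2 * (R * s) \<le> \<kappa> * s\<^sup>2"
    using mult_right_mono[OF s(3), of s] s by (simp add: power2_eq_square)
  have range: "0 \<le> j \<and> j \<le> int m \<and> (j < m)" if "\<bar>real_of_int j - c * real m\<bar> \<le> R * s" for j
  proof -
    have "c * real m + real m * (1 - c) = real m" by (simp add: algebra_simps)
    then have "real_of_int j > -1" "real_of_int j < real m"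
      using that Rs \<kappa> s by linarith+
    then show ?thesis by linarith
  qed
  show "0 \<le> x" "x \<le> int m" using range[OF x] by auto
  have m: "real m > 0" using range[OF x] by auto
  have mc: "1 / (real m * c) \<le> 1 / (\<kappa> * s\<^sup>2)" "1 / (real m * (1 - c)) \<le> 1 / (\<kappa> * s\<^sup>2)"
    using \<kappa> s c m by (auto intro!: divide_left_mono mult_pos_pos simp: mult.commute)
  have mcc: "1 / (2 * (real m * c * (1 - c))) \<le> 1 / (\<kappa> * s\<^sup>2)"
  proof -
    have "1 / (2 * (real m * c * (1 - c))) = (1 / (real m * c) + 1 / (real m * (1 - c))) / 2"
      using c m by (simp add: field_simps)
    also have "\<dots> \<le> (1 / (\<kappa> * s\<^sup>2) + 1 / (\<kappa> * s\<^sup>2)) / 2"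
      by (intro divide_right_mono add_mono mc) simp
    finally show ?thesis by simp
  qed
  define D where "D j = ln (binom_weight c m j) + (real_of_int j - c * real m)\<^sup>2 / (2 * (real m * c * (1 - c)))" for j
  \<comment> \<open>The second summand collects two Taylor remainders \<open>2 * w\<^sup>2\<close>
    with \<open>\<bar>w\<bar> \<le> R / (\<kappa> * s)\<close>; the first is what is left of the
    parabola once the linear terms have cancelled.\<close>
  define e where "e = (1 / \<kappa> + 4 * R\<^sup>2 / \<kappa>\<^sup>2) / s\<^sup>2"
  have small: "\<bar>t / q\<bar> \<le> R / (\<kappa> * s)" "\<bar>t / q\<bar> \<le> 1 / 2"
    if "\<bar>t\<bar> \<le> R * s" "\<kappa> * s\<^sup>2 \<le> q" for t q
  proof -
    have q: "q > 0" using that \<kappa> s by (meson less_le_trans mult_pos_pos zero_less_power)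
    have "\<bar>t / q\<bar> = \<bar>t\<bar> / q" using q by simp
    also have "\<dots> \<le> (R * s) / (\<kappa> * s\<^sup>2)"
      using that q \<kappa> s by (intro frac_le) auto
    also have "\<dots> = R / (\<kappa> * s)" using s \<kappa> by (simp add: power2_eq_square)
    finally show 1: "\<bar>t / q\<bar> \<le> R / (\<kappa> * s)" .
    have "R / (\<kappa> * s) \<le> 1 / 2" using s \<kappa> by (simp add: field_simps)
    then show "\<bar>t / q\<bar> \<le> 1 / 2" using 1 by linarith
  qed
  have step: "\<bar>D (j + 1) - D j\<bar> \<le> e"
    if j: "\<bar>real_of_int j - c * real m\<bar> \<le> R * s" "\<bar>real_of_int (j + 1) - c * real m\<bar> \<le> R * s" for j
  proof -
    define y where "y = real_of_int j - c * real m"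
    define t where "t = - (y / (real m * (1 - c)))"
    define u where "u = (y + 1) / (c * real m)"
    have y: "\<bar>y\<bar> \<le> R * s" "\<bar>y + 1\<bar> \<le> R * s" using j by (auto simp: y_def algebra_simps)
    have t: "\<bar>t\<bar> \<le> R / (\<kappa> * s)" "\<bar>t\<bar> \<le> 1 / 2"
      using small[OF y(1) \<kappa>(3)] by (auto simp: t_def)
    have u: "\<bar>u\<bar> \<le> R / (\<kappa> * s)" "\<bar>u\<bar> \<le> 1 / 2"
      using small[OF y(2) \<kappa>(2)] by (auto simp: u_def)
    have sq: "2 * w\<^sup>2 \<le> 2 * (R\<^sup>2 / \<kappa>\<^sup>2 / s\<^sup>2)" if "\<bar>w\<bar> \<le> R / (\<kappa> * s)" for w
      using power_mono[OF that, of 2] by (simp add: power_divide power_mult_distrib)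
    have lt: "\<bar>ln (1 + t) - t\<bar> \<le> 2 * (R\<^sup>2 / \<kappa>\<^sup>2 / s\<^sup>2)"
      using abs_ln_one_plus_x_minus_x_bound[OF t(2)] sq[OF t(1)] by linarith
    have lu: "\<bar>ln (1 + u) - u\<bar> \<le> 2 * (R\<^sup>2 / \<kappa>\<^sup>2 / s\<^sup>2)"
      using abs_ln_one_plus_x_minus_x_bound[OF u(2)] sq[OF u(1)] by linarith
    have "(real_of_int (j + 1) - c * real m)\<^sup>2 / (2 * (real m * c * (1 - c))) - y\<^sup>2 / (2 * (real m * c * (1 - c)))
        = (2 * y + 1) / (2 * (real m * c * (1 - c)))"
      by (simp add: y_def power2_eq_square algebra_simps flip: diff_divide_distrib)
    \<comment> \<open>The terms linear in \<open>y\<close> cancel because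
      \<open>1 / c + 1 / (1 - c) = 1 / (c * (1 - c))\<close>; this is what forces the variance
      \<open>m * c * (1 - c)\<close>.\<close>
    moreover have "(2 * y + 1) / (2 * (real m * c * (1 - c))) + t - u = (2 * c - 1) * (1 / (2 * (real m * c * (1 - c))))"
    proof -
      have t': "t = (- 2 * y * c) / (2 * (real m * c * (1 - c)))"
        using c m by (simp add: t_def)
      have u': "u = (2 * (y + 1) * (1 - c)) / (2 * (real m * c * (1 - c)))"
        using c m by (simp add: u_def frac_eq_eq)
      have "(2 * y + 1) + (- 2 * y * c) - (2 * (y + 1) * (1 - c)) = 2 * c - 1"
        by (simp add: algebra_simps)
      then show ?thesis
        unfolding t' u' by (simp only: flip: add_divide_distrib diff_divide_distrib) simp
    qed
    moreover have "\<bar>(2 * c - 1) * (1 / (2 * (real m * c * (1 - c))))\<bar> \<le> 1 * (1 / (\<kappa> * s\<^sup>2))"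
      unfolding abs_mult using c m mcc by (intro mult_mono) auto
    moreover have "ln (binom_weight c m (j + 1)) - ln (binom_weight c m j) = ln (1 + t) - ln (1 + u)"
      using ln_binom_weight_step(1)[OF c, of j m] range[OF j(1)] by (simp add: t_def u_def y_def)
    ultimately have "\<bar>D (j + 1) - D j\<bar> \<le> 1 / (\<kappa> * s\<^sup>2) + 4 * (R\<^sup>2 / \<kappa>\<^sup>2 / s\<^sup>2)"
      using lt lu unfolding D_def y_def[symmetric] by linarith
    also have "\<dots> = e" by (simp add: e_def add_divide_distrib)
    finally show ?thesis .
  qed
  have e: "e \<ge> 0" using \<kappa> by (simp add: e_def)
  have "\<bar>D x - D x0\<bar> \<le> e * \<bar>real_of_int x - real_of_int x0\<bar>"
  proof (cases "x0 \<le> x")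
    case True
    have "\<bar>D x - D x0\<bar> \<le> e * real_of_int (x - x0)"
    proof (rule abs_diff_le_of_int_steps[OF _ True])
      show "\<bar>D (j + 1) - D j\<bar> \<le> e" if "x0 \<le> j" "j < x" for j
        by (rule step) (use x x0 s that in linarith)+
    qed
    then show ?thesis using True by simp
  next
    case False
    have "\<bar>D x0 - D x\<bar> \<le> e * real_of_int (x0 - x)"
    proof (rule abs_diff_le_of_int_steps)
      show "\<bar>D (j + 1) - D j\<bar> \<le> e" if "x \<le> j" "j < x0" for j
        by (rule step) (use x x0 s that in linarith)+
    qed (use False in simp)
    then show ?thesis using False by (simp add: abs_minus_commute)
  qed
  also have "\<dots> \<le> e * (2 * (R * s))"
    using x x0 s e by (intro mult_left_mono) linarith+
  also have "\<dots> = 2 * R * (1 / \<kappa> + 4 * R\<^sup>2 / \<kappa>\<^sup>2) / s"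
    using s by (simp add: e_def power2_eq_square)
  finally have 1: "\<bar>D x - D x0\<bar> \<le> 2 * R * (1 / \<kappa> + 4 * R\<^sup>2 / \<kappa>\<^sup>2) / s" .
  have "(real_of_int x0 - c * real m)\<^sup>2 \<le> 1" using x0 by (simp add: abs_square_le_1)
  then have "(real_of_int x0 - c * real m)\<^sup>2 / (2 * (real m * c * (1 - c))) \<le> 1 / (2 * (real m * c * (1 - c)))"
    using c m by (intro divide_right_mono) auto
  then have 2: "(real_of_int x0 - c * real m)\<^sup>2 / (2 * (real m * c * (1 - c))) \<le> 1 / (\<kappa> * s\<^sup>2)"
    using mcc by linarith
  have 3: "(real_of_int x0 - c * real m)\<^sup>2 / (2 * (real m * c * (1 - c))) \<ge> 0"
    using c m by simp
  show "\<bar>ln (binom_weight c m x) - ln (binom_weight c m \<lfloor>c * real m\<rfloor>)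
        + (real_of_int x - c * real m)\<^sup>2 / (2 * (real m * c * (1 - c)))\<bar>
      \<le> 2 * R * (1 / \<kappa> + 4 * R\<^sup>2 / \<kappa>\<^sup>2) / s + 1 / (\<kappa> * s\<^sup>2)"
    using 1 2 3 unfolding D_def x0_def by linarith
qed

lemma binom_ratio_tendsto:
  fixes m :: "nat \<Rightarrow> nat" and x :: "nat \<Rightarrow> int"
  assumes cn: "cn \<longlonglongrightarrow> c" and c: "0 < c" "c < 1"
    and m: "(\<lambda>n. real (m n) / real n) \<longlonglongrightarrow> a" and a: "0 < a"
    and x: "(\<lambda>n. (real_of_int (x n) - cn n * real (m n)) / sqrt (real n)) \<longlonglongrightarrow> z"
  shows "(\<lambda>n. binom_ratio (cn n) (m n) (x n)) \<longlonglongrightarrow> exp (- (z\<^sup>2 / (2 * c * (1 - c) * a)))"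
proof -
  define R where "R = \<bar>z\<bar> + 1"
  \<comment> \<open>Half of the limits, so that \<open>m n / n * cn n\<close> and
    \<open>m n / n * (1 - cn n)\<close> exceed \<open>\<kappa>\<close> for all large n.\<close>
  define \<kappa> where "\<kappa> = min (a * c) (a * (1 - c)) / 2"
  have \<kappa>: "\<kappa> > 0" "\<kappa> < a * c" "\<kappa> < a * (1 - c)" using a c by (auto simp: \<kappa>_def min_def)
  have R: "R \<ge> 1" "\<bar>z\<bar> < R" by (auto simp: R_def)
  define y where "y n = real_of_int (x n) - cn n * real (m n)" for n
  define L where "L n = ln (binom_weight (cn n) (m n) (x n)) - ln (binom_weight (cn n) (m n) \<lfloor>cn n * real (m n)\<rfloor>)" for n
  have sq: "filterlim (\<lambda>n. sqrt (real n)) at_top sequentially"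
    by (rule filterlim_compose[OF sqrt_at_top filterlim_real_sequentially])
  have "eventually (\<lambda>n. 0 < cn n) sequentially" "eventually (\<lambda>n. cn n < 1) sequentially"
    using order_tendstoD[OF cn] c by auto
  moreover have "eventually (\<lambda>n. \<kappa> < real (m n) / real n * cn n) sequentially"
    by (rule order_tendstoD(1)[OF tendsto_mult[OF m cn]]) (use \<kappa> in simp)
  moreover have "eventually (\<lambda>n. \<kappa> < real (m n) / real n * (1 - cn n)) sequentially"
    by (rule order_tendstoD(1)[OF tendsto_mult[OF m tendsto_diff[OF tendsto_const cn]]]) (use \<kappa> in simp)
  moreover have "eventually (\<lambda>n. \<bar>y n / sqrt (real n)\<bar> < R) sequentially"
    by (rule order_tendstoD(2)[OF tendsto_rabs[OF x[folded y_def]]]) (use R in simp)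
  moreover have "eventually (\<lambda>n. sqrt (real n) \<ge> max 1 (2 * R / \<kappa>)) sequentially"
    using sq unfolding filterlim_at_top by blast
  ultimately have ev: "eventually (\<lambda>n. binom_ratio (cn n) (m n) (x n) = exp (L n) \<and>
      \<bar>L n + (y n)\<^sup>2 / (2 * (real (m n) * cn n * (1 - cn n)))\<bar> \<le>
        2 * R * (1 / \<kappa> + 4 * R\<^sup>2 / \<kappa>\<^sup>2) / sqrt (real n) + 1 / (\<kappa> * (sqrt (real n))\<^sup>2)) sequentially"
  proof eventually_elim
    case (elim n)
    define s where "s = sqrt (real n)"
    have s: "s \<ge> 1" "2 * R / \<kappa> \<le> s" "s\<^sup>2 = real n" using elim by (auto simp: s_def)
    then have n: "real n > 0" by (metis one_power2 power_mono zero_le_one less_le_trans zero_less_one)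
    have h1: "\<kappa> * s\<^sup>2 \<le> cn n * real (m n)" using elim n by (simp add: s field_simps)
    have h2: "\<kappa> * s\<^sup>2 \<le> real (m n) * (1 - cn n)" using elim n by (simp add: s field_simps)
    have h3: "1 \<le> R * s" using mult_mono[of 1 R 1 s] R s by simp
    have h4: "2 * R \<le> \<kappa> * s" using s \<kappa> by (simp add: field_simps)
    have "\<bar>y n\<bar> / s < R" using elim s by (simp add: s_def)
    then have h5: "\<bar>real_of_int (x n) - cn n * real (m n)\<bar> \<le> R * s"
      using s by (simp add: y_def field_simps)
    have s0: "0 < s" using s by simp
    note A = ln_binom_weight_approx[OF _ _ \<kappa>(1) h1 h2 h3 s0 h4 h5]
    show ?case
      using A binom_ratio_eq_exp[of "cn n" "x n" "m n"] elim by (auto simp: L_def y_def s_def)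
  qed
  have "(\<lambda>n. 2 * R * (1 / \<kappa> + 4 * R\<^sup>2 / \<kappa>\<^sup>2) / sqrt (real n) + 1 / (\<kappa> * (sqrt (real n))\<^sup>2)) \<longlonglongrightarrow> 0 + 0"
  proof (intro tendsto_add)
    show "(\<lambda>n. 2 * R * (1 / \<kappa> + 4 * R\<^sup>2 / \<kappa>\<^sup>2) / sqrt (real n)) \<longlonglongrightarrow> 0"
      by (rule real_tendsto_divide_at_top[OF tendsto_const sq])
    have "(\<lambda>n. (1 / \<kappa>) / real n) \<longlonglongrightarrow> 0"
      by (rule real_tendsto_divide_at_top[OF tendsto_const filterlim_real_sequentially])
    then show "(\<lambda>n. 1 / (\<kappa> * (sqrt (real n))\<^sup>2)) \<longlonglongrightarrow> 0" by simp
  qed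
  then have "(\<lambda>n. 2 * R * (1 / \<kappa> + 4 * R\<^sup>2 / \<kappa>\<^sup>2) / sqrt (real n) + 1 / (\<kappa> * (sqrt (real n))\<^sup>2)) \<longlonglongrightarrow> 0"
    by simp
  then have 1: "(\<lambda>n. L n + (y n)\<^sup>2 / (2 * (real (m n) * cn n * (1 - cn n)))) \<longlonglongrightarrow> 0"
    by (rule Lim_null_comparison[rotated]) (use ev in \<open>auto elim!: eventually_mono\<close>)
  have "(\<lambda>n. (y n / sqrt (real n))\<^sup>2 / (2 * (real (m n) / real n * cn n * (1 - cn n)))) \<longlonglongrightarrow> z\<^sup>2 / (2 * (a * c * (1 - c)))"
    using a c by (intro tendsto_intros x[folded y_def] m cn) auto
  moreover have "eventually (\<lambda>n. (y n / sqrt (real n))\<^sup>2 / (2 * (real (m n) / real n * cn n * (1 - cn n))) =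
      (y n)\<^sup>2 / (2 * (real (m n) * cn n * (1 - cn n)))) sequentially"
    using eventually_gt_at_top[of 0] by eventually_elim (simp add: power_divide)
  ultimately have 2: "(\<lambda>n. (y n)\<^sup>2 / (2 * (real (m n) * cn n * (1 - cn n)))) \<longlonglongrightarrow> z\<^sup>2 / (2 * (a * c * (1 - c)))"
    using tendsto_cong by fast
  have "(\<lambda>n. exp (L n)) \<longlonglongrightarrow> exp (0 - z\<^sup>2 / (2 * (a * c * (1 - c))))"
    using tendsto_diff[OF 1 2] by (intro tendsto_exp) simp
  moreover have "eventually (\<lambda>n. exp (L n) = binom_ratio (cn n) (m n) (x n)) sequentially"
    using ev by eventually_elim simp
  ultimately show ?thesis
    using tendsto_cong by (fastforce simp: mult_ac)
qed

section \<open>Translation-invariant measures on a subspace\<close>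

abbreviation lebesgue_prod :: "'j set \<Rightarrow> ('j \<Rightarrow> real) measure" where
  "lebesgue_prod J \<equiv> Pi\<^sub>M J (\<lambda>_. lborel)"

definition lin_comb :: "'j set \<Rightarrow> ('j \<Rightarrow> 'b::euclidean_space) \<Rightarrow> ('j \<Rightarrow> real) \<Rightarrow> 'b" where
  "lin_comb J v x = (\<Sum>j\<in>J. x j *\<^sub>R v j)"

lemma product_sigma_finite_lborel: "product_sigma_finite (\<lambda>_. lborel :: real measure)"
  by standard

lemma sigma_finite_lebesgue_prod: "finite J \<Longrightarrow> sigma_finite_measure (lebesgue_prod J)"
  by (rule product_sigma_finite.sigma_finite[OF product_sigma_finite_lborel])

lemma measurable_lin_comb [measurable]: "lin_comb J v \<in> borel_measurable (lebesgue_prod J)"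
  unfolding lin_comb_def[abs_def] by measurable

lemma lebesgue_prod_translate:
  assumes "finite J"
  shows "distr (lebesgue_prod J) (lebesgue_prod J) (\<lambda>x. \<lambda>j\<in>J. a j + x j) = lebesgue_prod J"
proof (rule product_sigma_finite.PiM_eqI[OF product_sigma_finite_lborel])
  fix A :: "'a \<Rightarrow> real set"
  assume A: "\<And>j. j \<in> J \<Longrightarrow> A j \<in> sets lborel"
  have "(\<lambda>x. \<lambda>j\<in>J. a j + x j) -` Pi\<^sub>E J A \<inter> space (lebesgue_prod J)
      = Pi\<^sub>E J (\<lambda>j. (+) (a j) -` A j)"
    by (auto simp: space_PiM PiE_iff)
  moreover have pre: "(+) (a j) -` A j \<in> sets lborel" if "j \<in> J" for j
  proof -
    have "(+) (a j) \<in> borel_measurable borel" by measurable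
    from measurable_sets[OF this, of "A j"] show ?thesis using A[OF that] by simp
  qed
  ultimately show "emeasure (distr (lebesgue_prod J) (lebesgue_prod J) (\<lambda>x. \<lambda>j\<in>J. a j + x j)) (Pi\<^sub>E J A)
      = (\<Prod>j\<in>J. emeasure lborel (A j))"
  proof (subst emeasure_distr)
    have "emeasure lborel ((+) (a j) -` A j) = emeasure lborel (A j)" if "j \<in> J" for j
      using A[OF that] by (subst (2) lborel_distr_plus[symmetric, of "a j"], subst emeasure_distr) auto
    moreover have "emeasure (lebesgue_prod J) (Pi\<^sub>E J (\<lambda>j. (+) (a j) -` A j))
        = (\<Prod>j\<in>J. emeasure lborel ((+) (a j) -` A j))"
      using pre by (intro product_sigma_finite.emeasure_PiM[OF product_sigma_finite_lborel assms])
    ultimately show "(\<lambda>x. \<lambda>j\<in>J. a j + x j) -` Pi\<^sub>E J A \<inter> space (lebesgue_prod J) = Pi\<^sub>E J (\<lambda>j. (+) (a j) -` A j) \<Longrightarrow>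
      emeasure (lebesgue_prod J) ((\<lambda>x. \<lambda>j\<in>J. a j + x j) -` Pi\<^sub>E J A \<inter> space (lebesgue_prod J)) =
      (\<Prod>j\<in>J. emeasure lborel (A j))"
      by simp
  qed (use A assms in \<open>auto intro!: sets_PiM_I_finite\<close>)
qed (use assms in auto)

text \<open>The shift \<open>w\<close> lifts to a coordinate vector \<open>a\<close>, and shifting
  by \<open>w\<close> after the linear map is shifting by \<open>a\<close> before it.\<close>

lemma nn_integral_lin_comb_translate:
  assumes J: "finite J" and F [measurable]: "F \<in> borel_measurable borel"
    and w: "w \<in> range (lin_comb J v)"
  shows "(\<integral>\<^sup>+x. F (w + lin_comb J v x) \<partial>lebesgue_prod J) = (\<integral>\<^sup>+x. F (lin_comb J v x) \<partial>lebesgue_prod J)"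
proof -
  obtain a where a: "w = lin_comb J v a" using w by auto
  have "lin_comb J v (\<lambda>j\<in>J. a j + x j) = w + lin_comb J v x" for x
    unfolding a lin_comb_def by (simp add: scaleR_add_left flip: sum.distrib)
  then show ?thesis
    by (subst (2) lebesgue_prod_translate[OF J, of a, symmetric]) (simp add: nn_integral_distr)
qed

text \<open>
  Uniqueness of translation-invariant measures on a subspace: the double integral of
  \<open>F (s + t) * G s\<close> is evaluated by shifting away \<open>s\<close> in the \<open>t\<close>-integral, and by shifting
  \<open>t\<close> into the other factor.
\<close>

lemma nn_integral_lin_comb_proportional:
  fixes v :: "'j \<Rightarrow> 'b::euclidean_space" and w :: "'k \<Rightarrow> 'b"
  assumes I: "finite I" and J: "finite J" and range: "range (lin_comb I v) = range (lin_comb J w)"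
    and F [measurable]: "F \<in> borel_measurable borel" and G [measurable]: "G \<in> borel_measurable borel"
    and even: "\<And>z. G (- z) = G z"
  shows "(\<integral>\<^sup>+x. F (lin_comb I v x) \<partial>lebesgue_prod I) * (\<integral>\<^sup>+y. G (lin_comb J w y) \<partial>lebesgue_prod J)
       = (\<integral>\<^sup>+x. G (lin_comb I v x) \<partial>lebesgue_prod I) * (\<integral>\<^sup>+y. F (lin_comb J w y) \<partial>lebesgue_prod J)"
proof -
  interpret pair_sigma_finite "lebesgue_prod I" "lebesgue_prod J"
    by (intro pair_sigma_finite.intro sigma_finite_lebesgue_prod I J)
  have neg: "- z \<in> range (lin_comb J w)" if "z \<in> range (lin_comb J w)" for z
  proof -
    from that obtain a where "z = lin_comb J w a" by auto
    then have "- z = lin_comb J w (\<lambda>j. - a j)" by (simp add: lin_comb_def sum_negf)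
    then show ?thesis by simp
  qed
  let ?L = "lin_comb I v" and ?L' = "lin_comb J w"
  have "(\<integral>\<^sup>+x. G (?L x) \<partial>lebesgue_prod I) * (\<integral>\<^sup>+y. F (?L' y) \<partial>lebesgue_prod J)
      = (\<integral>\<^sup>+x. G (?L x) * (\<integral>\<^sup>+y. F (?L' y) \<partial>lebesgue_prod J) \<partial>lebesgue_prod I)"
    by (simp add: nn_integral_multc)
  also have "\<dots> = (\<integral>\<^sup>+x. (\<integral>\<^sup>+y. G (?L x) * F (?L x + ?L' y) \<partial>lebesgue_prod J) \<partial>lebesgue_prod I)"
    by (intro nn_integral_cong, subst nn_integral_lin_comb_translate[OF J F, symmetric])
       (auto simp: range[symmetric] nn_integral_cmult)
  also have "\<dots> = (\<integral>\<^sup>+y. (\<integral>\<^sup>+x. G (?L x) * F (?L x + ?L' y) \<partial>lebesgue_prod I) \<partial>lebesgue_prod J)"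
    by (rule Fubini'[symmetric]) measurable
  also have "\<dots> = (\<integral>\<^sup>+y. (\<integral>\<^sup>+x. G (?L x - ?L' y) * F (?L x) \<partial>lebesgue_prod I) \<partial>lebesgue_prod J)"
  proof (rule nn_integral_cong)
    fix y
    have "(\<integral>\<^sup>+x. G ((?L' y + ?L x) - ?L' y) * F (?L' y + ?L x) \<partial>lebesgue_prod I)
        = (\<integral>\<^sup>+x. G (?L x - ?L' y) * F (?L x) \<partial>lebesgue_prod I)"
      by (rule nn_integral_lin_comb_translate[OF I]) (auto simp: range)
    then show "(\<integral>\<^sup>+x. G (?L x) * F (?L x + ?L' y) \<partial>lebesgue_prod I)
        = (\<integral>\<^sup>+x. G (?L x - ?L' y) * F (?L x) \<partial>lebesgue_prod I)"
      by (simp add: add.commute)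
  qed
  also have "\<dots> = (\<integral>\<^sup>+x. (\<integral>\<^sup>+y. G (?L x - ?L' y) * F (?L x) \<partial>lebesgue_prod J) \<partial>lebesgue_prod I)"
    by (rule Fubini') measurable
  also have "\<dots> = (\<integral>\<^sup>+x. F (?L x) * (\<integral>\<^sup>+y. G (?L' y) \<partial>lebesgue_prod J) \<partial>lebesgue_prod I)"
  proof (rule nn_integral_cong)
    fix x
    have "(\<integral>\<^sup>+y. G (?L' y) \<partial>lebesgue_prod J) = (\<integral>\<^sup>+y. G (- ?L x + ?L' y) \<partial>lebesgue_prod J)"
      using neg[of "?L x"] by (intro nn_integral_lin_comb_translate[OF J G, symmetric]) (auto simp flip: range)
    \<comment> \<open>Translation yields \<open>G\<close> at the negative of the desired point.
      Evenness of \<open>G\<close> takes the place of reflection invariance of the measure.\<close>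
    also have "\<dots> = (\<integral>\<^sup>+y. G (?L x - ?L' y) \<partial>lebesgue_prod J)"
      by (intro nn_integral_cong) (metis even minus_diff_eq uminus_add_conv_diff)
    finally show "(\<integral>\<^sup>+y. G (?L x - ?L' y) * F (?L x) \<partial>lebesgue_prod J)
        = F (?L x) * (\<integral>\<^sup>+y. G (?L' y) \<partial>lebesgue_prod J)"
      by (subst nn_integral_multc) (auto simp: mult.commute)
  qed
  also have "\<dots> = (\<integral>\<^sup>+x. F (?L x) \<partial>lebesgue_prod I) * (\<integral>\<^sup>+y. G (?L' y) \<partial>lebesgue_prod J)"
    by (simp add: nn_integral_multc)
  finally show ?thesis ..
qed

text \<open>The even weight \<open>f\<close> is used as the test function \<open>G\<close>, so that
  its two integrals serve as normalisations and the factor between the two measures never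
  appears.\<close>

lemma integral_lin_comb_proportional:
  fixes v :: "'j \<Rightarrow> 'b::euclidean_space" and w :: "'k \<Rightarrow> 'b" and f g :: "'b \<Rightarrow> real"
  assumes I: "finite I" and J: "finite J" and range: "range (lin_comb I v) = range (lin_comb J w)"
    and f [measurable]: "f \<in> borel_measurable borel" and f0: "\<And>z. f z \<ge> 0" and even: "\<And>z. f (- z) = f z"
    and int: "integrable (lebesgue_prod I) (\<lambda>x. f (lin_comb I v x))"
             "integrable (lebesgue_prod J) (\<lambda>y. f (lin_comb J w y))"
    and g [measurable]: "g \<in> borel_measurable borel" and bounded: "bounded (range g)"
  shows "(\<integral>x. f (lin_comb I v x) * g (lin_comb I v x) \<partial>lebesgue_prod I) * (\<integral>y. f (lin_comb J w y) \<partial>lebesgue_prod J)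
       = (\<integral>x. f (lin_comb I v x) \<partial>lebesgue_prod I) * (\<integral>y. f (lin_comb J w y) * g (lin_comb J w y) \<partial>lebesgue_prod J)"
proof -
  obtain C where C: "\<And>z. \<bar>g z\<bar> \<le> C"
    using bounded by (auto simp: bounded_iff)
  \<comment> \<open>Adding \<open>C\<close> makes the integrand nonnegative, so the identity for
    nonnegative integrals applies; the terms with \<open>C\<close> agree on both sides and cancel at
    the end.\<close>
  let ?h = "\<lambda>z. f z * (g z + C)"
  have gC: "g z + C \<ge> 0" for z using C[of z] by linarith
  then have h0: "?h z \<ge> 0" for z using f0 by simp
  have gint: "integrable (lebesgue_prod I) (\<lambda>x. f (lin_comb I v x) * g (lin_comb I v x))"
      "integrable (lebesgue_prod J) (\<lambda>x. f (lin_comb J w x) * g (lin_comb J w x))"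
    by (rule Bochner_Integration.integrable_bound[OF integrable_mult_left[OF int(1), of C]];
        use C f0 in \<open>auto simp: abs_mult intro!: mult_left_mono order_trans[OF C abs_ge_self]\<close>)
       (rule Bochner_Integration.integrable_bound[OF integrable_mult_left[OF int(2), of C]];
        use C f0 in \<open>auto simp: abs_mult intro!: mult_left_mono order_trans[OF C abs_ge_self]\<close>)
  have hint: "integrable (lebesgue_prod I) (\<lambda>x. ?h (lin_comb I v x))"
      "integrable (lebesgue_prod J) (\<lambda>x. ?h (lin_comb J w x))"
    using gint int by (simp_all add: distrib_left)
  have "(\<integral>\<^sup>+x. ?h (lin_comb I v x) \<partial>lebesgue_prod I) * (\<integral>\<^sup>+y. f (lin_comb J w y) \<partial>lebesgue_prod J)
      = (\<integral>\<^sup>+x. f (lin_comb I v x) \<partial>lebesgue_prod I) * (\<integral>\<^sup>+y. ?h (lin_comb J w y) \<partial>lebesgue_prod J)"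
    using even by (intro nn_integral_lin_comb_proportional[OF I J range, where F = "\<lambda>z. ennreal (?h z)" and G = "\<lambda>z. ennreal (f z)"]) auto
  then have "ennreal ((\<integral>x. ?h (lin_comb I v x) \<partial>lebesgue_prod I) * (\<integral>y. f (lin_comb J w y) \<partial>lebesgue_prod J))
      = ennreal ((\<integral>x. f (lin_comb I v x) \<partial>lebesgue_prod I) * (\<integral>y. ?h (lin_comb J w y) \<partial>lebesgue_prod J))"
    using int hint f0 h0
    by (simp add: nn_integral_eq_integral ennreal_mult integral_nonneg_AE)
  then have "(\<integral>x. ?h (lin_comb I v x) \<partial>lebesgue_prod I) * (\<integral>y. f (lin_comb J w y) \<partial>lebesgue_prod J)
      = (\<integral>x. f (lin_comb I v x) \<partial>lebesgue_prod I) * (\<integral>y. ?h (lin_comb J w y) \<partial>lebesgue_prod J)"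
    by (subst (asm) ennreal_inj) (use f0 h0 in \<open>auto intro!: mult_nonneg_nonneg integral_nonneg_AE\<close>)
  then show ?thesis
    using gint int by (simp add: distrib_left algebra_simps)
qed

section \<open>Gaussian integrals over product Lebesgue measure, and \<open>nu0\<close> in
  coordinates\<close>

lemma integral_pos_lebesgue_prod:
  assumes J: "finite J" and f: "integrable (lebesgue_prod J) f" and pos: "\<And>x. f x > (0::real)"
  shows "(\<integral>x. f x \<partial>lebesgue_prod J) > 0"
proof -
  have "(\<integral>x. f x \<partial>lebesgue_prod J) \<noteq> 0"
  proof
    assume "(\<integral>x. f x \<partial>lebesgue_prod J) = 0"
    then have "AE x in lebesgue_prod J. f x = 0"
      using integral_nonneg_eq_0_iff_AE[OF f] pos by (simp add: less_imp_le)
    then have "AE x in lebesgue_prod J. False"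
      using pos by (auto elim!: eventually_mono simp: less_imp_neq[symmetric])
    then have "emeasure (lebesgue_prod J) (space (lebesgue_prod J)) = 0"
      by (simp add: AE_iff_null null_sets_def)
    moreover have "emeasure (lebesgue_prod J) (space (lebesgue_prod J)) = (\<Prod>j\<in>J. emeasure lborel (UNIV :: real set))"
      unfolding space_PiM
      using product_sigma_finite.emeasure_PiM[OF product_sigma_finite_lborel J, of "\<lambda>_. UNIV"] by simp
    \<comment> \<open>For empty \<open>J\<close>, which is the case of a single block, the measure
      is a point mass and the product is 1; otherwise the product is infinite.\<close>
    ultimately show False using J by (auto simp: prod_zero_iff)
  qed
  moreover have "(\<integral>x. f x \<partial>lebesgue_prod J) \<ge> 0" using pos by (intro integral_nonneg_AE) (simp add: less_imp_le)
  ultimately show ?thesis by simp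
qed

lemma integrable_prod_gaussian:
  fixes \<delta> :: real
  assumes "\<delta> > 0" "finite J"
  shows "integrable (lebesgue_prod J) (\<lambda>x. \<Prod>j\<in>J. exp (- (\<delta> * (x j)\<^sup>2)))"
proof (rule product_sigma_finite.product_integrable_prod[OF product_sigma_finite_lborel \<open>finite J\<close>, where f = "\<lambda>_ x. exp (- (\<delta> * x\<^sup>2))"])
  \<comment> \<open>This variance makes the integrand a multiple of
    \<open>normal_density 0 \<sigma>\<close>, whose moment of order 0 is integrable.\<close>
  define \<sigma> where "\<sigma> = sqrt (1 / (2 * \<delta>))"
  have \<sigma>: "\<sigma> > 0" "2 * \<sigma>\<^sup>2 = 1 / \<delta>" using assms by (auto simp: \<sigma>_def)
  have "(\<lambda>x. exp (- (\<delta> * x\<^sup>2))) = (\<lambda>x. sqrt (2 * pi * \<sigma>\<^sup>2) * normal_density 0 \<sigma> x)"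
    using \<sigma> assms by (auto simp: normal_density_def fun_eq_iff)
  then show "integrable lborel (\<lambda>x. exp (- (\<delta> * x\<^sup>2)))"
    using \<sigma> integrable_normal_moment[of \<sigma> 0 0] by simp
qed

lemma orthonormal_basis_of_SOME:
  assumes "subspace S"
  obtains B where "orthonormal_basis_of S B" "finite B"
    "subspace_lborel S = distr (lebesgue_prod B) (restrict_space borel S) (lin_comb B (\<lambda>b. b))"
proof -
  define B where "B = (SOME B. orthonormal_basis_of S B)"
  have B: "orthonormal_basis_of S B"
    unfolding B_def using orthonormal_basis_of_exists[OF assms] by (rule someI_ex)
  then have "finite B"
    by (auto simp: orthonormal_basis_of_def intro: pairwise_orthogonal_imp_finite)
  moreover have "subspace_lborel S = distr (lebesgue_prod B) (restrict_space borel S) (lin_comb B (\<lambda>b. b))"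
    by (simp add: subspace_lborel_def Let_def B_def[symmetric] lin_comb_def[abs_def])
  ultimately show ?thesis using B that by blast
qed

lemma range_lin_comb_basis:
  assumes "finite B" "span B = S"
  shows "range (lin_comb B (\<lambda>b. b)) = S"
  using span_finite[OF assms(1)] assms(2) by (auto simp: lin_comb_def)

lemma nu0_lin_comb:
  obtains B :: "(real^'i::finite) set" where "orthonormal_basis_of zero_sum_space B" "finite B"
    "nu0 = distr (lebesgue_prod B) borel (lin_comb B (\<lambda>b. b))"
proof -
  obtain B :: "(real^'i) set" where B: "orthonormal_basis_of zero_sum_space B" "finite B"
    "subspace_lborel zero_sum_space = distr (lebesgue_prod B) (restrict_space borel zero_sum_space) (lin_comb B (\<lambda>b. b))"
    by (rule orthonormal_basis_of_SOME[OF subspace_zero_sum_space])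
  have "lin_comb B (\<lambda>b. b) \<in> lebesgue_prod B \<rightarrow>\<^sub>M restrict_space borel zero_sum_space"
    using range_lin_comb_basis[OF B(2), of zero_sum_space] B(1)
    by (intro measurable_restrict_space2) (auto simp: orthonormal_basis_of_def)
  then have "nu0 = distr (lebesgue_prod B) borel (lin_comb B (\<lambda>b. b))"
    unfolding nu0_def B(3) by (subst distr_distr) (auto simp: comp_def intro: measurable_restrict_space1)
  with B show ?thesis using that by blast
qed

text \<open>Turns a bound that depends only on the norm into a product of one-dimensional Gaussians
  in the basis coordinates.\<close>

lemma norm_lin_comb_orthonormal:
  assumes "orthonormal_basis_of S B" "finite B"
  shows "(norm (lin_comb B (\<lambda>b. b) x))\<^sup>2 = (\<Sum>b\<in>B. (x b)\<^sup>2)"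
proof -
  have "(norm (lin_comb B (\<lambda>b. b) x))\<^sup>2 = (\<Sum>b\<in>B. (norm (x b *\<^sub>R b))\<^sup>2)"
    unfolding lin_comb_def using assms
    by (intro norm_sum_Pythagorean) (auto simp: pairwise_def orthonormal_basis_of_def orthogonal_clauses)
  also have "\<dots> = (\<Sum>b\<in>B. (x b)\<^sup>2)"
    using assms by (intro sum.cong) (auto simp: orthonormal_basis_of_def)
  finally show ?thesis .
qed

section \<open>Lattice sums on the hyperplane\<close>

text \<open>The hyperplane in terms of its coordinates other than \<open>i0\<close>, which is where
  lattice points are easy to describe. It is written as a \<open>lin_comb\<close> so that the
  comparison with an orthonormal basis applies; the vectors used here are not orthonormal as soon as
  there are two blocks.\<close>

definition chart :: "'i::finite \<Rightarrow> ('i \<Rightarrow> real) \<Rightarrow> real^'i" where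
  "chart i0 = lin_comb (- {i0}) (\<lambda>j. axis j 1 - axis i0 1)"

lemma chart_nth: "chart i0 u $ i = (if i = i0 then - (\<Sum>j\<in>-{i0}. u j) else u i)"
proof (cases "i = i0")
  case True
  have "chart i0 u $ i0 = (\<Sum>j\<in>-{i0}. - u j)"
    unfolding chart_def lin_comb_def by (simp, intro sum.cong) (auto simp: axis_def)
  then show ?thesis using True by (simp add: sum_negf)
next
  case False
  have "chart i0 u $ i = (\<Sum>j\<in>-{i0}. if j = i then u j else 0)"
    unfolding chart_def lin_comb_def sum_component using False by (intro sum.cong) (auto simp: axis_def)
  then show ?thesis using False by simp
qed

lemma sum_split_off: "(\<Sum>i\<in>UNIV. f i) = f i0 + (\<Sum>i\<in>-{i0}. f i)" for f :: "'i::finite \<Rightarrow> 'b::comm_monoid_add"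
  by (simp add: sum.remove[of UNIV i0] Compl_eq_Diff_UNIV)

lemma prod_split_off: "(\<Prod>i\<in>UNIV. f i) = f i0 * (\<Prod>i\<in>-{i0}. f i)" for f :: "'i::finite \<Rightarrow> 'b::comm_monoid_mult"
  by (simp add: prod.remove[of UNIV i0] Compl_eq_Diff_UNIV)

lemma range_chart: "range (chart i0) = zero_sum_space"
proof (intro equalityI subsetI)
  fix z assume "z \<in> range (chart i0)"
  then obtain u where u: "z = chart i0 u" by auto
  have "(\<Sum>i\<in>-{i0}. chart i0 u $ i) = (\<Sum>i\<in>-{i0}. u i)"
    by (intro sum.cong) (auto simp: chart_nth)
  then show "z \<in> zero_sum_space"
    unfolding u zero_sum_space_def by (simp add: sum_split_off[of _ i0]) (simp add: chart_nth)
next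
  fix z :: "real^'a" assume "z \<in> zero_sum_space"
  then have "z = chart i0 (\<lambda>i. z $ i)"
    by (simp add: vec_eq_iff chart_nth zero_sum_space_def sum_split_off[of _ i0])
  then show "z \<in> range (chart i0)" by blast
qed

lemma chart_in_zero_sum_space: "chart i0 u \<in> zero_sum_space"
  using range_chart by blast

lemma measurable_chart [measurable]: "chart i0 \<in> borel_measurable (lebesgue_prod (- {i0}))"
  unfolding chart_def by (rule measurable_lin_comb)

text \<open>As a function of \<open>u\<close> this is constant on boxes of side 1 / sqrt n, and for
  n > 0 every integer point with sum \<open>k\<close> is taken on exactly one box. That is what
  makes a lattice sum an integral.\<close>

definition lattice_point :: "'i::finite \<Rightarrow> nat \<Rightarrow> ('i \<Rightarrow> nat) \<Rightarrow> ('i \<Rightarrow> real) \<Rightarrow> nat \<Rightarrow> ('i \<Rightarrow> real) \<Rightarrow> 'i \<Rightarrow> int" where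
  "lattice_point i0 n m c k u =
     (let y = \<lambda>j. \<lfloor>c j * real (m j) + sqrt (real n) * u j\<rfloor>
      in y(i0 := int k - (\<Sum>j\<in>-{i0}. y j)))"

definition rescale :: "nat \<Rightarrow> ('i::finite \<Rightarrow> nat) \<Rightarrow> ('i \<Rightarrow> real) \<Rightarrow> ('i \<Rightarrow> int) \<Rightarrow> real^'i" where
  "rescale n m c x = (\<chi> i. (real_of_int (x i) - c i * real (m i)) / sqrt (real n))"

lemma lattice_point_nth:
  "i \<noteq> i0 \<Longrightarrow> lattice_point i0 n m c k u i = \<lfloor>c i * real (m i) + sqrt (real n) * u i\<rfloor>"
  by (simp add: lattice_point_def Let_def)

lemma sum_lattice_point: "(\<Sum>i\<in>UNIV. lattice_point i0 n m c k u i) = int k"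
  by (simp add: lattice_point_def Let_def sum_split_off[of _ i0])

lemma rescale_lattice_point_nth_le:
  assumes "n > 0" "i \<noteq> i0"
  shows "\<bar>rescale n m c (lattice_point i0 n m c k u) $ i - u i\<bar> \<le> 1 / sqrt (real n)"
proof -
  let ?t = "c i * real (m i) + sqrt (real n) * u i"
  have s: "sqrt (real n) > 0" using assms by simp
  have "rescale n m c (lattice_point i0 n m c k u) $ i - u i = (real_of_int \<lfloor>?t\<rfloor> - ?t) / sqrt (real n)"
    using s assms by (simp add: rescale_def lattice_point_nth diff_divide_distrib add_divide_distrib)
  moreover have "\<bar>real_of_int \<lfloor>?t\<rfloor> - ?t\<bar> \<le> 1" by linarith
  ultimately show ?thesis using s by (simp add: divide_right_mono)
qed

lemma rescale_in_zero_sum_space: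
  assumes "(\<Sum>i\<in>UNIV. c i * real (m i)) = real k" "(\<Sum>i\<in>UNIV. x i) = int k"
  shows "rescale n m c x \<in> zero_sum_space"
proof -
  have "(\<Sum>i\<in>UNIV. real_of_int (x i)) = real k" using assms(2) by (metis of_int_of_nat_eq of_int_sum)
  then show ?thesis
    using assms by (simp add: rescale_def zero_sum_space_def sum_subtractf flip: sum_divide_distrib)
qed

text \<open>Away from \<open>i0\<close> the rounding error is at most 1 / sqrt n. The
  \<open>i0\<close> coordinate is minus the sum of the others, because the means and the lattice
  point both have total \<open>k\<close>.\<close>

lemma rescale_lattice_point_tendsto:
  assumes sum: "eventually (\<lambda>n. (\<Sum>i\<in>UNIV. c n i * real (m n i)) = real (k n)) sequentially"
  shows "(\<lambda>n. rescale n (m n) (c n) (lattice_point i0 n (m n) (c n) (k n) u)) \<longlonglongrightarrow> chart i0 u"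
proof (rule vec_tendstoI)
  let ?z = "\<lambda>n. rescale n (m n) (c n) (lattice_point i0 n (m n) (c n) (k n) u)"
  have 1: "(\<lambda>n. ?z n $ i) \<longlonglongrightarrow> u i" if "i \<noteq> i0" for i
  proof -
    have "(\<lambda>n. ?z n $ i - u i) \<longlonglongrightarrow> 0"
    proof (rule Lim_null_comparison)
      show "eventually (\<lambda>n. norm (?z n $ i - u i) \<le> 1 / sqrt (real n)) sequentially"
        using eventually_gt_at_top[of 0]
        by eventually_elim (use rescale_lattice_point_nth_le[OF _ that] in auto)
      show "(\<lambda>n. 1 / sqrt (real n)) \<longlonglongrightarrow> 0"
        by (intro real_tendsto_divide_at_top[OF tendsto_const]
            filterlim_compose[OF sqrt_at_top filterlim_real_sequentially])
    qed
    then show ?thesis by (simp add: LIM_zero_iff)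
  qed
  fix i
  show "(\<lambda>n. ?z n $ i) \<longlonglongrightarrow> chart i0 u $ i"
  proof (cases "i = i0")
    case True
    have "(\<lambda>n. - (\<Sum>j\<in>-{i0}. ?z n $ j)) \<longlonglongrightarrow> - (\<Sum>j\<in>-{i0}. u j)"
      by (intro tendsto_minus tendsto_sum 1) auto
    moreover have "eventually (\<lambda>n. - (\<Sum>j\<in>-{i0}. ?z n $ j) = ?z n $ i0) sequentially"
      using sum
    proof eventually_elim
      case (elim n)
      have "?z n \<in> zero_sum_space" by (rule rescale_in_zero_sum_space[OF elim sum_lattice_point])
      then show ?case by (simp add: zero_sum_space_def sum_split_off[of _ i0])
    qed
    ultimately show ?thesis using True tendsto_cong by (fastforce simp: chart_nth)
  qed (use 1 in \<open>simp add: chart_nth\<close>)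
qed

text \<open>A point \<open>x\<close> is hit exactly on the half-open box \<open>Q x\<close>, whose
  volume is the same for all \<open>x\<close>. Since \<open>F\<close> lives on the finite set
  \<open>A\<close>, the integrand is a finite combination of indicators of such boxes.\<close>

lemma integral_lattice_point:
  fixes F :: "('i::finite \<Rightarrow> int) \<Rightarrow> real"
  assumes n: "n > 0" and A: "finite A" "\<And>x. x \<in> A \<Longrightarrow> (\<Sum>i\<in>UNIV. x i) = int k"
    and F: "\<And>x. (\<Sum>i\<in>UNIV. x i) = int k \<Longrightarrow> x \<notin> A \<Longrightarrow> F x = 0"
  shows "integrable (lebesgue_prod (- {i0})) (\<lambda>u. F (lattice_point i0 n m c k u))" (is ?int)
    and "(\<integral>u. F (lattice_point i0 n m c k u) \<partial>lebesgue_prod (- {i0})) =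
           (1 / sqrt (real n)) ^ card (- {i0}) * (\<Sum>x\<in>A. F x)" (is ?eq)
proof -
  let ?M = "lebesgue_prod (- {i0})"
  define s where "s = sqrt (real n)"
  have s: "s > 0" using n by (simp add: s_def)
  define I where "I x j = {(real_of_int (x j) - c j * real (m j)) / s ..<
      (real_of_int (x j) - c j * real (m j) + 1) / s}" for x :: "'i \<Rightarrow> int" and j
  have I: "t \<in> I x j \<longleftrightarrow> \<lfloor>c j * real (m j) + s * t\<rfloor> = x j" for t x j
    using s by (auto simp: I_def floor_eq_iff field_simps)
  define Q where "Q x = Pi\<^sub>E (- {i0}) (I x)" for x
  have Q: "lattice_point i0 n m c k u = x \<longleftrightarrow> u \<in> Q x" if "u \<in> space ?M" "x \<in> A" for u x
  proof
    assume "lattice_point i0 n m c k u = x"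
    then show "u \<in> Q x" using that(1)
      by (auto simp: Q_def space_PiM PiE_iff I s_def) (metis lattice_point_nth)
  next
    assume "u \<in> Q x"
    then have 1: "lattice_point i0 n m c k u j = x j" if "j \<noteq> i0" for j
      using that by (auto simp: Q_def PiE_iff I s_def lattice_point_nth)
    then have "(\<Sum>j\<in>-{i0}. lattice_point i0 n m c k u j) = (\<Sum>j\<in>-{i0}. x j)" by (intro sum.cong) auto
    \<comment> \<open>The box says nothing about coordinate \<open>i0\<close>; equal totals recover
      it.\<close>
    moreover have "(\<Sum>i\<in>UNIV. lattice_point i0 n m c k u i) = (\<Sum>i\<in>UNIV. x i)"
      using A(2)[OF \<open>x \<in> A\<close>] by (simp only: sum_lattice_point)
    ultimately have "lattice_point i0 n m c k u i0 = x i0"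
      by (simp add: sum_split_off[of _ i0])
    with 1 show "lattice_point i0 n m c k u = x" by (metis ext)
  qed
  have em: "emeasure ?M (Q x) = ennreal ((1 / s) ^ card (- {i0}))" for x
  proof -
    have "emeasure ?M (Q x) = (\<Prod>j\<in>-{i0}. emeasure lborel (I x j))"
      unfolding Q_def by (rule product_sigma_finite.emeasure_PiM[OF product_sigma_finite_lborel]) (auto simp: I_def)
    also have "\<dots> = (\<Prod>j\<in>-{i0}. ennreal (1 / s))"
      using s by (intro prod.cong) (auto simp: I_def divide_right_mono add_divide_distrib)
    also have "\<dots> = ennreal ((1 / s) ^ card (- {i0}))"
      using s by (simp add: ennreal_power)
    finally show ?thesis .
  qed
  have Qm: "Q x \<in> sets ?M" for x
    unfolding Q_def by (intro sets_PiM_I_finite) (auto simp: I_def)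
  have rep: "F (lattice_point i0 n m c k u) = (\<Sum>x\<in>A. F x * indicator (Q x) u)" if "u \<in> space ?M" for u
  proof -
    have "(\<Sum>x\<in>A. F x * indicator (Q x) u) = (\<Sum>x\<in>A. if lattice_point i0 n m c k u = x then F x else 0)"
      using Q[OF that] by (intro sum.cong) (auto simp: indicator_def)
    also have "\<dots> = F (lattice_point i0 n m c k u)"
      using A(1) F[OF sum_lattice_point] by auto
    finally show ?thesis ..
  qed
  have int: "integrable ?M (\<lambda>u. F x * indicator (Q x) u)" for x
    using Qm em by (intro integrable_mult_right integrable_real_indicator) auto
  show ?int
    by (subst Bochner_Integration.integrable_cong[OF refl rep])
       (auto intro!: Bochner_Integration.integrable_sum int)
  have "(\<integral>u. F (lattice_point i0 n m c k u) \<partial>?M) = (\<integral>u. (\<Sum>x\<in>A. F x * indicator (Q x) u) \<partial>?M)"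
    by (rule Bochner_Integration.integral_cong[OF refl rep])
  also have "\<dots> = (\<Sum>x\<in>A. F x * measure ?M (Q x))"
    using int Qm em sets.sets_into_space[OF Qm] by (subst Bochner_Integration.integral_sum) (auto simp: Int_absorb2)
  also have "\<dots> = (\<Sum>x\<in>A. F x * (1 / s) ^ card (- {i0}))"
    using em s by (simp add: measure_def)
  finally show ?eq unfolding s_def sum_distrib_right[symmetric] by (simp only: mult.commute)
qed

section \<open>Dominated convergence for the lattice sums\<close>

definition lattice_weight :: "('i::finite \<Rightarrow> nat) \<Rightarrow> ('i \<Rightarrow> real) \<Rightarrow> ('i \<Rightarrow> int) \<Rightarrow> real" where
  "lattice_weight m c x = (\<Prod>i\<in>UNIV. binom_ratio (c i) (m i) (x i))"

lemma lattice_weight_tendsto: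
  assumes cn: "\<And>i. (\<lambda>n. cn n i) \<longlonglongrightarrow> c i" and c: "\<And>i. 0 < c i \<and> c i < 1"
    and m: "\<And>i. (\<lambda>n. real (m n i) / real n) \<longlonglongrightarrow> a i" and a: "\<And>i. 0 < a i"
    and sum: "eventually (\<lambda>n. (\<Sum>i\<in>UNIV. cn n i * real (m n i)) = real (k n)) sequentially"
  shows "(\<lambda>n. lattice_weight (m n) (cn n) (lattice_point i0 n (m n) (cn n) (k n) u))
           \<longlonglongrightarrow> limit_weight c a (chart i0 u)"
proof -
  have "(\<lambda>n. binom_ratio (cn n i) (m n i) (lattice_point i0 n (m n) (cn n) (k n) u i))
      \<longlonglongrightarrow> exp (- ((chart i0 u $ i)\<^sup>2 / (2 * c i * (1 - c i) * a i)))" for i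
    using tendsto_vec_nth[OF rescale_lattice_point_tendsto[OF sum, of i0 u], of i] c
    by (intro binom_ratio_tendsto[OF cn _ _ m a]) (auto simp: rescale_def)
  then show ?thesis
    unfolding lattice_weight_def limit_weight_def
    unfolding indicator_eq_1_iff[THEN iffD2, OF chart_in_zero_sum_space] mult_1
    by (intro tendsto_prod)
qed

text \<open>The majorant must not depend on n: \<open>m i \<le> n\<close> replaces the variance
  \<open>m i\<close> of \<open>binom_ratio_le\<close> by n, which rescaling removes, and
  \<open>K\<close> bounds the constants. In \<open>exp (K + 2)\<close>, the part
  \<open>K + 1\<close> comes from \<open>binom_ratio_le\<close> and 1 from rounding. For
  \<open>i0\<close> only the constant is kept.\<close>

lemma lattice_weight_le:
  fixes m :: "'i::finite \<Rightarrow> nat"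
  assumes c: "\<And>i. 0 < c i \<and> c i < 1" and K: "\<And>i. 1 / (1 - c i) \<le> K"
    and m: "\<And>i. 0 < m i" "\<And>i. m i \<le> n"
  shows "lattice_weight m c (lattice_point i0 n m c k u)
           \<le> exp (K + 2) ^ CARD('i) * (\<Prod>j\<in>-{i0}. exp (- (1 / 4 * (u j)\<^sup>2)))"
proof -
  let ?x = "lattice_point i0 n m c k u"
  have n: "n > 0" using m[of undefined] by linarith
  have b: "binom_ratio (c i) (m i) (?x i) \<le> exp (K + 1) * exp (- ((rescale n m c ?x $ i)\<^sup>2 / 2))" for i
  proof -
    have "(rescale n m c ?x $ i)\<^sup>2 / 2 = (real_of_int (?x i) - c i * real (m i))\<^sup>2 / (2 * real n)"
      by (simp add: rescale_def power_divide)
    also have "\<dots> \<le> (real_of_int (?x i) - c i * real (m i))\<^sup>2 / (2 * real (m i))"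
      using m[of i] n by (intro divide_left_mono) auto
    finally have 1: "exp (- ((real_of_int (?x i) - c i * real (m i))\<^sup>2 / (2 * real (m i)))) \<le> exp (- ((rescale n m c ?x $ i)\<^sup>2 / 2))"
      by simp
    have "binom_ratio (c i) (m i) (?x i) \<le> exp (1 / (1 - c i) + 1) * exp (- ((real_of_int (?x i) - c i * real (m i))\<^sup>2 / (2 * real (m i))))"
      using c[of i] m[of i] by (intro binom_ratio_le) auto
    also have "\<dots> \<le> exp (K + 1) * exp (- ((rescale n m c ?x $ i)\<^sup>2 / 2))"
      using K[of i] by (intro mult_mono 1) auto
    finally show ?thesis .
  qed
  have "lattice_weight m c ?x \<le> (\<Prod>i\<in>UNIV. exp (K + 2) * (if i = i0 then 1 else exp (- (1 / 4 * (u i)\<^sup>2))))"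
    unfolding lattice_weight_def
  proof (intro prod_mono conjI binom_ratio_nonneg)
    fix i
    let ?z = "rescale n m c ?x $ i"
    \<comment> \<open>From \<open>u\<^sup>2 \<le> 2 * z\<^sup>2 + 2 * (z - u)\<^sup>2\<close> with
      rounding error at most 1: passing from \<open>z\<close> to \<open>u\<close> halves the rate to
      1/4 and costs 1 in the exponent.\<close>
    have "- (?z\<^sup>2 / 2) \<le> 1 + (if i = i0 then 0 else - (1 / 4 * (u i)\<^sup>2))"
    proof (cases "i = i0")
      case False
      have "\<bar>?z - u i\<bar> \<le> 1 / sqrt (real n)" by (rule rescale_lattice_point_nth_le[OF n False])
      also have "\<dots> \<le> 1" using n by simp
      finally have "(?z - u i)\<^sup>2 \<le> 1" by (simp add: abs_square_le_1)
      moreover have "(u i)\<^sup>2 \<le> 2 * ?z\<^sup>2 + 2 * (?z - u i)\<^sup>2"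
        using zero_le_power2[of "2 * ?z - u i"] by (simp add: power2_eq_square algebra_simps)
      ultimately show ?thesis using False by simp
    next
      case True
      show ?thesis unfolding if_P[OF True] using zero_le_power2[of ?z] by linarith
    qed
    then have "K + 1 + - (?z\<^sup>2 / 2) \<le> K + 2 + (if i = i0 then 0 else - (1 / 4 * (u i)\<^sup>2))"
      by linarith
    then have "exp (K + 1) * exp (- (?z\<^sup>2 / 2)) \<le> exp (K + 2) * exp (if i = i0 then 0 else - (1 / 4 * (u i)\<^sup>2))"
      by (simp only: exp_le_cancel_iff flip: exp_add)
    also have "exp (if i = i0 then 0 else - (1 / 4 * (u i)\<^sup>2)) = (if i = i0 then 1 else exp (- (1 / 4 * (u i)\<^sup>2)))"
      by (simp only: if_distrib[of exp] exp_zero)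
    finally show "binom_ratio (c i) (m i) (?x i) \<le> exp (K + 2) * (if i = i0 then 1 else exp (- (1 / 4 * (u i)\<^sup>2)))"
      using b[of i] by (rule order_trans[rotated])
  qed (use c in auto)
  also have "\<dots> = exp (K + 2) ^ CARD('i) * (\<Prod>i\<in>UNIV. if i = i0 then 1 else exp (- (1 / 4 * (u i)\<^sup>2)))"
    by (simp only: prod.distrib prod_constant)
  also have "(\<Prod>i\<in>UNIV. if i = i0 then 1 else exp (- (1 / 4 * (u i)\<^sup>2))) = (\<Prod>j\<in>-{i0}. exp (- (1 / 4 * (u j)\<^sup>2)))"
    by (subst prod_split_off[of _ i0]) (auto intro!: prod.cong)
  finally show ?thesis .
qed

lemma lattice_weight_nonneg:
  "(\<And>i. 0 < c i \<and> c i < 1) \<Longrightarrow> lattice_weight m c x \<ge> 0"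
  unfolding lattice_weight_def by (intro prod_nonneg binom_ratio_nonneg) auto

lemma lattice_weight_eq_0:
  "x i < 0 \<or> int (m i) < x i \<Longrightarrow> lattice_weight m c x = 0"
  unfolding lattice_weight_def by (rule prod_zero) (auto intro!: exI[of _ i] binom_ratio_eq_0)

definition counts_with_sum :: "nat \<Rightarrow> ('i::finite \<Rightarrow> nat) set" where
  "counts_with_sum k = {x. (\<Sum>i\<in>UNIV. x i) = k}"

lemma finite_counts_with_sum: "finite (counts_with_sum k)"
proof (rule finite_subset)
  show "counts_with_sum k \<subseteq> Pi\<^sub>E UNIV (\<lambda>_. {..k})"
    by (auto simp: counts_with_sum_def PiE_UNIV_domain intro!: member_le_sum)
qed (intro finite_PiE; simp)

text \<open>An integer point with sum \<open>k\<close> that is not a vector of counts has a negative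
  coordinate, where the weight vanishes; so the sum over the hyperplane runs over finitely many
  count vectors.\<close>

lemma integral_lattice_weight:
  fixes m :: "'i::finite \<Rightarrow> nat" and c :: "'i \<Rightarrow> real" and g :: "real^'i \<Rightarrow> real"
  assumes n: "n > 0"
  defines "F \<equiv> \<lambda>x. lattice_weight m c x * g (rescale n m c x)"
  shows "integrable (lebesgue_prod (- {i0})) (\<lambda>u. F (lattice_point i0 n m c k u))"
    and "(\<integral>u. F (lattice_point i0 n m c k u) \<partial>lebesgue_prod (- {i0})) =
           (1 / sqrt (real n)) ^ card (- {i0}) * (\<Sum>x\<in>counts_with_sum k. F (\<lambda>i. int (x i)))"
proof -
  let ?emb = "\<lambda>(x :: 'i \<Rightarrow> nat) i. int (x i)"
  define A where "A = ?emb ` counts_with_sum k"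
  have fin: "finite A" by (simp add: A_def finite_counts_with_sum)
  have sum: "(\<Sum>i\<in>UNIV. x i) = int k" if "x \<in> A" for x
    using that by (auto simp: A_def counts_with_sum_def)
  have F0: "F x = 0" if "(\<Sum>i\<in>UNIV. x i) = int k" "x \<notin> A" for x
  proof -
    have "\<exists>i. x i < 0"
    proof (rule ccontr)
      assume "\<not> (\<exists>i. x i < 0)"
      then have x: "x = ?emb (\<lambda>i. nat (x i))" by (auto simp: fun_eq_iff not_less)
      have "int (\<Sum>i\<in>UNIV. nat (x i)) = int k"
        using that(1) by (subst (asm) x) simp
      then have "(\<lambda>i. nat (x i)) \<in> counts_with_sum k"
        unfolding counts_with_sum_def by (simp only: of_nat_eq_iff mem_Collect_eq)
      have "x \<in> A" unfolding A_def by (subst x, rule imageI, fact)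
      then show False using that(2) by simp
    qed
    then show ?thesis unfolding F_def using lattice_weight_eq_0 by fastforce
  qed
  show "integrable (lebesgue_prod (- {i0})) (\<lambda>u. F (lattice_point i0 n m c k u))"
    by (rule integral_lattice_point(1)[OF n fin sum F0])
  have "inj_on ?emb (counts_with_sum k)" by (auto simp: inj_on_def fun_eq_iff)
  then have "(\<Sum>x\<in>A. F x) = (\<Sum>x\<in>counts_with_sum k. F (?emb x))"
    unfolding A_def by (simp add: sum.reindex)
  then show "(\<integral>u. F (lattice_point i0 n m c k u) \<partial>lebesgue_prod (- {i0})) =
           (1 / sqrt (real n)) ^ card (- {i0}) * (\<Sum>x\<in>counts_with_sum k. F (\<lambda>i. int (x i)))"
    by (simp add: integral_lattice_point(2)[where F = F, OF n fin sum F0])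
qed

lemma borel_measurable_limit_weight [measurable]: "limit_weight c a \<in> borel_measurable borel"
proof -
  have "zero_sum_space \<in> sets (borel :: (real^'a) measure)"
    by (intro borel_closed closed_subspace subspace_zero_sum_space)
  moreover have "(\<lambda>z. exp (- ((z $ i)\<^sup>2 / (2 * c i * (1 - c i) * a i)))) \<in> borel_measurable borel" for i
    by measurable
  ultimately show ?thesis
    unfolding limit_weight_def[abs_def]
    by (intro borel_measurable_times borel_measurable_indicator borel_measurable_prod)
qed

text \<open>The majorant also makes the limit integrable; with \<open>g\<close> constant 1 this
  supplies the integrability of the limit weight in the chart.\<close>

lemma lattice_integral_tendsto:
  fixes m :: "nat \<Rightarrow> 'i::finite \<Rightarrow> nat" and g :: "real^'i \<Rightarrow> real"
  assumes cn: "\<And>i. (\<lambda>n. cn n i) \<longlonglongrightarrow> c i" and c: "\<And>i. 0 < c i \<and> c i < 1"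
    and m: "\<And>i. (\<lambda>n. real (m n i) / real n) \<longlonglongrightarrow> a i" and a: "\<And>i. 0 < a i"
    and mn: "\<forall>n\<ge>1. (\<Sum>i\<in>UNIV. m n i) = n"
    and sum: "eventually (\<lambda>n. (\<Sum>i\<in>UNIV. cn n i * real (m n i)) = real (k n)) sequentially"
    and g: "continuous_on UNIV g" "bounded (range g)"
  defines "F \<equiv> \<lambda>n x. lattice_weight (m n) (cn n) x * g (rescale n (m n) (cn n) x)"
  shows "(\<lambda>n. \<integral>u. F n (lattice_point i0 n (m n) (cn n) (k n) u) \<partial>lebesgue_prod (- {i0}))
           \<longlonglongrightarrow> (\<integral>u. limit_weight c a (chart i0 u) * g (chart i0 u) \<partial>lebesgue_prod (- {i0}))" (is ?lim)
    and "integrable (lebesgue_prod (- {i0})) (\<lambda>u. limit_weight c a (chart i0 u) * g (chart i0 u))" (is ?int)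
proof -
  let ?M = "lebesgue_prod (- {i0})"
  obtain C where C: "\<And>z. \<bar>g z\<bar> \<le> C" using g(2) by (auto simp: bounded_iff)
  \<comment> \<open>Eventually \<open>1 - cn n i\<close> is at least half of \<open>1 - c i\<close>,
    hence the 2; the sum bounds all blocks at once.\<close>
  define K where "K = (\<Sum>i\<in>UNIV. 2 / (1 - c i))"
  have K: "2 / (1 - c i) \<le> K" for i
    unfolding K_def
    by (rule member_le_sum[where f = "\<lambda>i. 2 / (1 - c i)"]) (use c in \<open>auto simp: le_less\<close>)
  have ev1: "eventually (\<lambda>n. 0 < cn n i \<and> cn n i < 1 \<and> 1 / (1 - cn n i) \<le> K) sequentially" for i
  proof -
    have "eventually (\<lambda>n. 0 < cn n i) sequentially"
      "eventually (\<lambda>n. cn n i < (1 + c i) / 2) sequentially"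
      using order_tendstoD(1)[OF cn[of i], of 0] order_tendstoD(2)[OF cn[of i], of "(1 + c i) / 2"] c[of i] by simp_all
    then show ?thesis
    proof eventually_elim
      case (elim n)
      have "1 / (1 - cn n i) \<le> 1 / ((1 - c i) / 2)"
        using elim c[of i] by (intro divide_left_mono mult_pos_pos) auto
      then show ?case using K[of i] elim c[of i] by auto
    qed
  qed
  have ev2: "eventually (\<lambda>n. 0 < m n i) sequentially" for i
    using order_tendstoD(1)[OF m a, of i] by eventually_elim (auto intro: gr0I)
  have "eventually (\<lambda>n. (\<forall>i. 0 < cn n i \<and> cn n i < 1 \<and> 1 / (1 - cn n i) \<le> K) \<and> (\<forall>i. 0 < m n i) \<and> n \<ge> 1) sequentially"
    using eventually_all_finite[OF ev1] eventually_all_finite[OF ev2] eventually_ge_at_top[of 1]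
    by eventually_elim auto
  then obtain N where N: "\<And>n. n \<ge> N \<Longrightarrow>
      (\<forall>i. 0 < cn n i \<and> cn n i < 1 \<and> 1 / (1 - cn n i) \<le> K) \<and> (\<forall>i. 0 < m n i) \<and> n \<ge> 1"
    unfolding eventually_sequentially by blast
  \<comment> \<open>The majorant is available only from \<open>N\<close> on, while dominated
    convergence asks for it at every index; the shift by \<open>N\<close> is removed at the
    end.\<close>
  define s where "s n u = F (n + N) (lattice_point i0 (n + N) (m (n + N)) (cn (n + N)) (k (n + N)) u)" for n u
  define w where "w u = exp (K + 2) ^ CARD('i) * (\<Prod>j\<in>-{i0}. exp (- (1 / 4 * (u j)\<^sup>2))) * C" for u :: "'i \<Rightarrow> real"
  let ?f = "\<lambda>u. limit_weight c a (chart i0 u) * g (chart i0 u)"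
  have [measurable]: "g \<in> borel_measurable borel" using g(1) by (rule borel_measurable_continuous_onI)
  have fm: "?f \<in> borel_measurable ?M" by measurable
  have sm: "s n \<in> borel_measurable ?M" for n
    unfolding s_def F_def using N[of "n + N"]
    by (intro borel_measurable_integrable integral_lattice_weight(1)) auto
  have wint: "integrable ?M w"
    unfolding w_def by (intro integrable_mult_left integrable_mult_right integrable_prod_gaussian) auto
  have lim: "(\<lambda>n. s n u) \<longlonglongrightarrow> ?f u" for u
  proof -
    have gc: "isCont g z" for z using g(1) by (simp add: continuous_on_eq_continuous_at)
    have "(\<lambda>n. F n (lattice_point i0 n (m n) (cn n) (k n) u)) \<longlonglongrightarrow> ?f u"
      unfolding F_def
      by (intro tendsto_mult lattice_weight_tendsto[OF cn c m a sum]
          isCont_tendsto_compose[OF gc] rescale_lattice_point_tendsto[OF sum])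
    then show ?thesis unfolding s_def by (rule LIMSEQ_ignore_initial_segment)
  qed
  have bound: "norm (s n u) \<le> w u" for n u
  proof -
    let ?n = "n + N"
    have mle: "m ?n i \<le> ?n" for i
    proof -
      have "m ?n i \<le> (\<Sum>i\<in>UNIV. m ?n i)" by (rule member_le_sum) auto
      then show ?thesis using mn N[of ?n] by auto
    qed
    have "norm (s n u) = lattice_weight (m ?n) (cn ?n) (lattice_point i0 ?n (m ?n) (cn ?n) (k ?n) u)
        * \<bar>g (rescale ?n (m ?n) (cn ?n) (lattice_point i0 ?n (m ?n) (cn ?n) (k ?n) u))\<bar>"
      unfolding s_def F_def using N[of ?n] by (simp add: abs_mult lattice_weight_nonneg)
    also have "\<dots> \<le> w u"
      unfolding w_def
    proof (rule mult_mono)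
      show "lattice_weight (m ?n) (cn ?n) (lattice_point i0 ?n (m ?n) (cn ?n) (k ?n) u)
          \<le> exp (K + 2) ^ CARD('i) * (\<Prod>j\<in>-{i0}. exp (- (1 / 4 * (u j)\<^sup>2)))"
        by (rule lattice_weight_le) (use N[of ?n] mle in auto)
    qed (use C in \<open>auto intro!: mult_nonneg_nonneg prod_nonneg\<close>)
    finally show ?thesis .
  qed
  have "(\<lambda>n. integral\<^sup>L ?M (s n)) \<longlonglongrightarrow> integral\<^sup>L ?M ?f"
    by (rule integral_dominated_convergence[OF fm sm wint]) (simp_all add: lim bound del: real_norm_def)
  then show ?lim unfolding s_def by (rule LIMSEQ_offset)
  show ?int
    by (rule integrable_dominated_convergence[where s = s, OF fm sm wint]) (simp_all add: lim bound del: real_norm_def)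
qed

section \<open>Tilting and the conditional law\<close>

text \<open>The common value \<open>D\<close> of the system is the counterpart of \<open>A\<close>
  at finite n: it solves the same equation, with block sizes and \<open>k\<close> in place of their
  limiting proportions. The index \<open>undefined\<close> only names some block, as the system
  makes the expression equal for all.\<close>

lemma tilt_system_odds:
  assumes c: "solves_tilt_system p m k c" and p: "\<And>i. 0 < p i \<and> p i < 1"
  defines "D \<equiv> (1 - c undefined) / c undefined * (p undefined / (1 - p undefined))"
  shows "D > 0" and "p i / (1 - p i) = D * (c i / (1 - c i))" and "c i = p i / (p i + D * (1 - p i))"
    and "(\<Sum>i\<in>UNIV. p i * real (m i) / (p i + D * (1 - p i))) = real k"
proof -
  have c01: "0 < c i \<and> c i < 1" for i
    using c by (auto simp: solves_tilt_system_def)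
  have D: "(1 - c i) / c i * (p i / (1 - p i)) = D" for i
    using c unfolding solves_tilt_system_def D_def by blast
  show Dpos: "D > 0"
    using c01[of undefined] p[of undefined] unfolding D_def by auto
  show "p i / (1 - p i) = D * (c i / (1 - c i))"
    using D[of i, symmetric] c01[of i] by simp
  have di: "c i = p i / (p i + D * (1 - p i))" for i
  proof -
    have "p i + D * (1 - p i) > 0"
      using p[of i] Dpos by (simp add: add_pos_pos)
    moreover have "(1 - c i) * p i = D * c i * (1 - p i)"
      using D[of i] c01[of i] p[of i] by (simp add: field_simps)
    ultimately show ?thesis
      by (simp add: field_simps)
  qed
  show "c i = p i / (p i + D * (1 - p i))" by (rule di)
  have "(\<Sum>i\<in>UNIV. c i * real (m i)) = real k"
    using c by (simp add: solves_tilt_system_def)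
  then show "(\<Sum>i\<in>UNIV. p i * real (m i) / (p i + D * (1 - p i))) = real k"
    by (subst (asm) di) simp
qed

section \<open>Convergence of the tilting parameters\<close>

lemma tilt_sum_mono:
  fixes p b :: "'i::finite \<Rightarrow> real"
  assumes p: "\<And>i. 0 < p i \<and> p i < 1" and b: "\<And>i. 0 < b i" and A: "0 < A" "A < B"
  shows "(\<Sum>i\<in>UNIV. p i * b i / (p i + B * (1 - p i))) < (\<Sum>i\<in>UNIV. p i * b i / (p i + A * (1 - p i)))"
proof (rule sum_strict_mono)
  fix i
  have "p i + A * (1 - p i) > 0" "p i + B * (1 - p i) > 0"
    using p[of i] A by (auto intro!: add_pos_pos)
  then show "p i * b i / (p i + B * (1 - p i)) < p i * b i / (p i + A * (1 - p i))"
    using p[of i] b[of i] A by (intro divide_strict_left_mono mult_pos_pos) auto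
qed auto

text \<open>The odds factors \<open>D n\<close> converge to \<open>A0\<close> by monotonicity alone.
  For fixed \<open>A < A0\<close> the equation's left-hand side at \<open>A\<close> tends to a value
  above \<open>\<alpha>\<close>, so for large n it exceeds its value \<open>k n / n\<close> at
  \<open>D n\<close>; being decreasing, it forces \<open>A < D n\<close>. The other side is
  symmetric, so pointwise convergence in \<open>A\<close> is enough.\<close>

lemma tilted_prob_tendsto:
  fixes a p :: "'i::finite \<Rightarrow> real" and m :: "nat \<Rightarrow> 'i \<Rightarrow> nat" and k :: "nat \<Rightarrow> nat"
  assumes a: "\<And>i. 0 < a i" "(\<Sum>i\<in>UNIV. a i) = 1" and \<alpha>: "0 < \<alpha>" "\<alpha> < 1"
    and p: "\<And>i. 0 < p i \<and> p i < 1" and mn: "\<forall>n\<ge>1. (\<Sum>i\<in>UNIV. m n i) = n"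
    and m: "\<And>i. (\<lambda>n. real (m n i) / real n) \<longlonglongrightarrow> a i"
    and k: "(\<lambda>n. real (k n) / real n) \<longlonglongrightarrow> \<alpha>"
  shows "eventually (\<lambda>n. solves_tilt_system p (m n) (k n) (tilted_prob p (m n) (k n))) sequentially" (is ?ev)
    and "(\<lambda>n. tilted_prob p (m n) (k n) i) \<longlonglongrightarrow> limit_prob p a \<alpha> i" (is ?lim)
    and "0 < limit_prob p a \<alpha> i \<and> limit_prob p a \<alpha> i < 1" (is ?bounds)
proof -
  define c where "c n = tilted_prob p (m n) (k n)" for n
  define D where "D n = (1 - c n undefined) / c n undefined * (p undefined / (1 - p undefined))" for n
  define A0 where "A0 = tilt_const p a \<alpha>"
  define h where "h b A = (\<Sum>i\<in>UNIV. p i * b i / (p i + A * (1 - p i)))" for b A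
  have mpos: "eventually (\<lambda>n. 0 < m n i) sequentially" for i
    using order_tendstoD(1)[OF m a(1), of i] by eventually_elim (auto intro: gr0I)
  \<comment> \<open>Positive block sizes and \<open>0 < k n < n\<close>, from which existence and
    uniqueness follow, hold for large n because the limits are strictly between the
    extremes.\<close>
  have ev: "eventually (\<lambda>n. solves_tilt_system p (m n) (k n) (c n) \<and> (\<forall>i. 0 < m n i) \<and> n > 0) sequentially"
    using eventually_all_finite[where P = "\<lambda>n i. 0 < m n i", OF mpos] order_tendstoD(1)[OF k \<alpha>(1)] order_tendstoD(2)[OF k \<alpha>(2)] eventually_gt_at_top[of 0]
  proof eventually_elim
    case (elim n)
    have "\<exists>!c. solves_tilt_system p (m n) (k n) c"
    proof (rule tilted_prob_ex1[OF p])
      show "0 < m n i" for i using elim by blast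
      show "0 < k n" using elim by (intro gr0I) auto
      have "real (k n) < real n" using elim by (simp add: field_simps)
      then show "k n < (\<Sum>i\<in>UNIV. m n i)" using mn elim by auto
    qed
    then show ?case unfolding c_def tilted_prob_def using elim theI' by metis
  qed
  then show ?ev unfolding c_def by eventually_elim simp
  have A0: "A0 > 0" "h a A0 = \<alpha>"
    unfolding h_def A0_def tilt_const_def
    using theI'[OF tilt_const_ex1[of p a \<alpha>]] p a \<alpha> by auto
  have hlim: "(\<lambda>n. h (\<lambda>i. real (m n i) / real n) A) \<longlonglongrightarrow> h a A" if "A > 0" for A
    unfolding h_def
  proof (intro tendsto_intros m)
    show "p i + A * (1 - p i) \<noteq> 0" for i
      using p[of i] that by (intro less_imp_neq[symmetric] add_pos_pos) auto
  qed
  have evD: "eventually (\<lambda>n. D n > 0 \<and> h (\<lambda>i. real (m n i) / real n) (D n) = real (k n) / real n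
      \<and> (\<forall>i. c n i = p i / (p i + D n * (1 - p i))) \<and> (\<forall>i. 0 < real (m n i) / real n)) sequentially"
    using ev
  proof eventually_elim
    case (elim n)
    then have s: "solves_tilt_system p (m n) (k n) (c n)" by simp
    note t = tilt_system_odds[OF s p, folded D_def]
    have "h (\<lambda>i. real (m n i) / real n) (D n) = (\<Sum>i\<in>UNIV. p i * real (m n i) / (p i + D n * (1 - p i))) / real n"
      unfolding h_def sum_divide_distrib by (intro sum.cong) (auto simp: mult.commute)
    then show ?case using t elim by simp
  qed
  have Dlim: "D \<longlonglongrightarrow> A0"
  proof (rule order_tendstoI)
    fix A assume A: "A < A0"
    show "eventually (\<lambda>n. A < D n) sequentially"
    proof (cases "A > 0")
      case True
      have "\<alpha> < h a A" using tilt_sum_mono[of p a, OF p a(1) True A] A0 by (simp add: h_def)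
      then have "eventually (\<lambda>n. 0 < h (\<lambda>i. real (m n i) / real n) A - real (k n) / real n) sequentially"
        by (intro order_tendstoD(1)[OF tendsto_diff[OF hlim[OF True] k]]) simp
      with evD show ?thesis
      proof eventually_elim
        case (elim n)
        show ?case
        proof (rule ccontr)
          assume "\<not> A < D n"
          then have "h (\<lambda>i. real (m n i) / real n) A \<le> h (\<lambda>i. real (m n i) / real n) (D n)"
            using tilt_sum_mono[of p "\<lambda>i. real (m n i) / real n" "D n" A] p elim
            unfolding h_def by (cases "A = D n") (auto simp: less_imp_le)
          with elim show False by simp
        qed
      qed
    qed (use evD in \<open>auto elim!: eventually_mono\<close>)
  next
    fix A assume A: "A0 < A"
    have "h a A < \<alpha>" using tilt_sum_mono[of p a, OF p a(1) A0(1) A] A0 by (simp add: h_def)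
    then have "eventually (\<lambda>n. h (\<lambda>i. real (m n i) / real n) A - real (k n) / real n < 0) sequentially"
      using A A0 by (intro order_tendstoD(2)[OF tendsto_diff[OF hlim k]]) auto
    with evD show "eventually (\<lambda>n. D n < A) sequentially"
    proof eventually_elim
      case (elim n)
      show ?case
      proof (rule ccontr)
        assume "\<not> D n < A"
        then have "h (\<lambda>i. real (m n i) / real n) (D n) \<le> h (\<lambda>i. real (m n i) / real n) A"
          using tilt_sum_mono[of p "\<lambda>i. real (m n i) / real n" A "D n"] p elim A A0
          unfolding h_def by (cases "A = D n") (auto simp: less_imp_le)
        with elim show False by simp
      qed
    qed
  qed
  have den: "p i + A0 * (1 - p i) > 0"
    using p[of i] A0 by (intro add_pos_pos) auto
  have "(\<lambda>n. p i / (p i + D n * (1 - p i))) \<longlonglongrightarrow> limit_prob p a \<alpha> i"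
    unfolding limit_prob_def A0_def[symmetric] using den by (intro tendsto_intros Dlim) auto
  moreover have "eventually (\<lambda>n. p i / (p i + D n * (1 - p i)) = c n i) sequentially"
    using evD by eventually_elim simp
  ultimately show ?lim unfolding c_def using tendsto_cong by fast
  show ?bounds
    unfolding limit_prob_def A0_def[symmetric] using den p[of i] A0 by simp
qed

section \<open>The conditional law at a fixed n\<close>

lemma normalized_vec_eq_rescale:
  "normalized_vec n m c X \<omega> = rescale n m c (\<lambda>i. int (X i \<omega>))"
  by (simp add: normalized_vec_def rescale_def)

lemma borel_measurable_normalized_vec:
  assumes "\<And>i. X i \<in> M \<rightarrow>\<^sub>M count_space UNIV"
  shows "normalized_vec n m c X \<in> borel_measurable M"
proof -
  have [measurable]: "(\<lambda>\<omega>. real (X i \<omega>)) \<in> borel_measurable M" for i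
    by (rule measurable_compose[OF assms]) simp
  have "(\<lambda>\<omega>. normalized_vec n m c X \<omega> \<bullet> axis i 1) \<in> borel_measurable M" for i
    unfolding normalized_vec_def inner_axis by simp
  then show ?thesis
    by (subst borel_measurable_euclidean_space) (auto simp: Basis_vec_def)
qed

locale binomial_counts = prob_space M for M :: "'a measure" +
  fixes X :: "'i::finite \<Rightarrow> 'a \<Rightarrow> nat" and m :: "'i \<Rightarrow> nat" and p :: "'i \<Rightarrow> real"
  assumes p: "\<And>i. 0 < p i \<and> p i < 1"
    and indep: "indep_vars (\<lambda>_. count_space UNIV) X UNIV"
    and distr: "\<And>i. distr M (count_space UNIV) (X i) = measure_pmf (binomial_pmf (m i) (p i))"
begin

lemma measurable_X [measurable]: "X i \<in> M \<rightarrow>\<^sub>M count_space UNIV"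
  using indep unfolding indep_vars_def by auto

definition counts_event :: "('i \<Rightarrow> nat) \<Rightarrow> 'a set" where
  "counts_event x = {\<omega> \<in> space M. \<forall>i. X i \<omega> = x i}"

lemma sets_counts_event [measurable]: "counts_event x \<in> sets M"
  unfolding counts_event_def by measurable

lemma prob_counts_event:
  "prob (counts_event x) = (\<Prod>i\<in>UNIV. real (m i choose x i) * p i ^ x i * (1 - p i) ^ (m i - x i))"
proof -
  have "counts_event x = (\<Inter>i\<in>UNIV. X i -` {x i} \<inter> space M)"
    by (auto simp: counts_event_def)
  then have "prob (counts_event x) = (\<Prod>i\<in>UNIV. prob (X i -` {x i} \<inter> space M))"
    using indep_varsD[OF indep, of UNIV "\<lambda>i. {x i}"] by simp
  also have "\<dots> = (\<Prod>i\<in>UNIV. pmf (binomial_pmf (m i) (p i)) (x i))"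
  proof (rule prod.cong)
    fix i
    have "prob (X i -` {x i} \<inter> space M) = measure (distr M (count_space UNIV) (X i)) {x i}"
      by (subst measure_distr) auto
    then show "prob (X i -` {x i} \<inter> space M) = pmf (binomial_pmf (m i) (p i)) (x i)"
      unfolding distr by (simp add: pmf.rep_eq)
  qed simp
  finally show ?thesis using p by (simp add: less_imp_le)
qed

text \<open>The odds of \<open>p\<close> are \<open>D\<close> times those of \<open>c\<close> in
  every block, so replacing one by the other changes the probability of a count vector by a factor
  depending only on the total count: \<open>D ^ k\<close>.\<close>

lemma prob_counts_event_tilt:
  assumes c: "solves_tilt_system p m k c"
  obtains K where "K > 0"
    "\<And>x. x \<in> counts_with_sum k \<Longrightarrow> prob (counts_event x) = K * lattice_weight m c (\<lambda>i. int (x i))"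
proof -
  obtain D where D: "D > 0" "\<And>i. p i / (1 - p i) = D * (c i / (1 - c i))"
    using tilt_system_odds(1,2)[OF c p] by blast
  have c01: "0 < c i" "c i < 1" for i using c by (auto simp: solves_tilt_system_def)
  define w where "w i = binom_weight (c i) (m i) \<lfloor>c i * real (m i)\<rfloor>" for i
  have w: "w i > 0" for i
    unfolding w_def by (intro binom_weight_pos floor_mean_bounds c01)
  \<comment> \<open>The factor \<open>(1 - p i) ^ m i\<close> is split off to pass from
    probabilities to odds; \<open>w i\<close> undoes the normalisation in
    \<open>binom_ratio\<close>.\<close>
  define K where "K = D ^ k * (\<Prod>i\<in>UNIV. (1 - p i) ^ m i * w i)"
  have "K > 0" unfolding K_def using D p w by (intro mult_pos_pos zero_less_power prod_pos) auto
  moreover have "prob (counts_event x) = K * lattice_weight m c (\<lambda>i. int (x i))" if x: "x \<in> counts_with_sum k" for x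
  proof -
    have "real (m i choose x i) * p i ^ x i * (1 - p i) ^ (m i - x i)
        = D ^ x i * ((1 - p i) ^ m i * w i) * binom_ratio (c i) (m i) (int (x i))" for i
    proof (cases "x i \<le> m i")
      case True
      have "p i ^ x i * (1 - p i) ^ (m i - x i) = (p i / (1 - p i)) ^ x i * (1 - p i) ^ m i"
        using p[of i] True by (simp add: power_divide power_diff)
      also have "\<dots> = D ^ x i * (c i / (1 - c i)) ^ x i * (1 - p i) ^ m i"
        unfolding D(2) by (simp only: power_mult_distrib)
      finally have "real (m i choose x i) * p i ^ x i * (1 - p i) ^ (m i - x i)
          = D ^ x i * (1 - p i) ^ m i * binom_weight (c i) (m i) (int (x i))"
        using True by (simp add: binom_weight_def)
      also have "binom_weight (c i) (m i) (int (x i)) = w i * binom_ratio (c i) (m i) (int (x i))"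
        using w[of i] by (simp add: binom_ratio_def w_def)
      finally show ?thesis by simp
    qed (simp add: binom_ratio_eq_0)
    then have "prob (counts_event x) = (\<Prod>i\<in>UNIV. D ^ x i) * (\<Prod>i\<in>UNIV. (1 - p i) ^ m i * w i) * lattice_weight m c (\<lambda>i. int (x i))"
      unfolding prob_counts_event lattice_weight_def by (simp only: prod.distrib)
    also have "(\<Prod>i\<in>UNIV. D ^ x i) = D ^ k"
      using x by (simp add: counts_with_sum_def flip: power_sum)
    finally show ?thesis by (simp add: K_def)
  qed
  ultimately show ?thesis using that by blast
qed

lemma conditional_law_integral:
  fixes g :: "real^'i \<Rightarrow> real"
  assumes c: "solves_tilt_system p m k c" and g [measurable]: "g \<in> borel_measurable borel"
    and pos: "(\<Sum>x\<in>counts_with_sum k. lattice_weight m c (\<lambda>i. int (x i))) > 0"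
  shows "(\<integral>z. g z \<partial>conditional_law M (normalized_vec n m c X) (\<lambda>\<omega>. (\<Sum>i\<in>UNIV. X i \<omega>) = k)) =
     (\<Sum>x\<in>counts_with_sum k. lattice_weight m c (\<lambda>i. int (x i)) * g (rescale n m c (\<lambda>i. int (x i)))) /
     (\<Sum>x\<in>counts_with_sum k. lattice_weight m c (\<lambda>i. int (x i)))"
proof -
  obtain K where K: "K > 0"
    "\<And>x. x \<in> counts_with_sum k \<Longrightarrow> prob (counts_event x) = K * lattice_weight m c (\<lambda>i. int (x i))"
    by (rule prob_counts_event_tilt[OF c]) blast
  define E where "E = {\<omega> \<in> space M. (\<Sum>i\<in>UNIV. X i \<omega>) = k}"
  have [measurable]: "E \<in> sets M" unfolding E_def by measurable
  have [measurable]: "normalized_vec n m c X \<in> borel_measurable M"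
    by (rule borel_measurable_normalized_vec) measurable
  \<comment> \<open>Stated for every \<open>G\<close>: constant 1 gives the probability of
    \<open>E\<close>, and \<open>g\<close> gives the numerator, so that \<open>K\<close>
    cancels.\<close>
  have decomp: "(\<integral>\<omega>. indicator E \<omega> * G (normalized_vec n m c X \<omega>) \<partial>M) =
      K * (\<Sum>x\<in>counts_with_sum k. lattice_weight m c (\<lambda>i. int (x i)) * G (rescale n m c (\<lambda>i. int (x i))))"
    for G :: "real^'i \<Rightarrow> real"
  proof -
    have "(\<integral>\<omega>. indicator E \<omega> * G (normalized_vec n m c X \<omega>) \<partial>M) =
       (\<integral>\<omega>. (\<Sum>x\<in>counts_with_sum k. indicator (counts_event x) \<omega> * G (rescale n m c (\<lambda>i. int (x i)))) \<partial>M)"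
    proof (rule Bochner_Integration.integral_cong[OF refl])
      fix \<omega> assume \<omega>: "\<omega> \<in> space M"
      have "(\<Sum>x\<in>counts_with_sum k. indicator (counts_event x) \<omega> * G (rescale n m c (\<lambda>i. int (x i)))) =
          (\<Sum>x\<in>counts_with_sum k. if x = (\<lambda>i. X i \<omega>) then G (rescale n m c (\<lambda>i. int (X i \<omega>))) else 0)"
        using \<omega> by (intro sum.cong) (auto simp: counts_event_def indicator_def fun_eq_iff, metis)
      also have "\<dots> = (if (\<lambda>i. X i \<omega>) \<in> counts_with_sum k then G (rescale n m c (\<lambda>i. int (X i \<omega>))) else 0)"
        by (simp add: finite_counts_with_sum)
      also have "\<dots> = indicator E \<omega> * G (normalized_vec n m c X \<omega>)"
        using \<omega> by (simp add: normalized_vec_eq_rescale E_def counts_with_sum_def)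
      finally show "indicator E \<omega> * G (normalized_vec n m c X \<omega>) =
        (\<Sum>x\<in>counts_with_sum k. indicator (counts_event x) \<omega> * G (rescale n m c (\<lambda>i. int (x i))))" ..
    qed
    also have "\<dots> = (\<Sum>x\<in>counts_with_sum k. prob (counts_event x) * G (rescale n m c (\<lambda>i. int (x i))))"
      by (subst Bochner_Integration.integral_sum)
         (auto intro!: integrable_mult_left integrable_real_indicator simp: emeasure_eq_measure)
    finally show ?thesis
      by (simp add: K(2) sum_distrib_left mult.assoc)
  qed
  have E: "prob E = K * (\<Sum>x\<in>counts_with_sum k. lattice_weight m c (\<lambda>i. int (x i)))"
    using decomp[of "\<lambda>_. 1"] by simp
  then have Epos: "prob E > 0" using K pos by simp
  have "uniform_measure M E = density M (\<lambda>\<omega>. ennreal (indicator E \<omega> / prob E))"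
    unfolding uniform_measure_def emeasure_eq_measure using Epos
    by (intro arg_cong[of _ _ "density M"] ext) (auto simp: indicator_def divide_ennreal[of 1, simplified])
  then have "(\<integral>z. g z \<partial>conditional_law M (normalized_vec n m c X) (\<lambda>\<omega>. (\<Sum>i\<in>UNIV. X i \<omega>) = k)) =
      (\<integral>\<omega>. (indicator E \<omega> / prob E) * g (normalized_vec n m c X \<omega>) \<partial>M)"
    unfolding conditional_law_def E_def[symmetric]
    by (simp add: integral_distr integral_density measurable_density_eq1)
  also have "\<dots> = (\<integral>\<omega>. indicator E \<omega> * g (normalized_vec n m c X \<omega>) \<partial>M) / prob E"
    by simp
  finally show ?thesis unfolding decomp E using K(1) by simp
qed

end

section \<open>The limit law in chart coordinates\<close>

lemma limit_weight_even: "limit_weight c a (- z) = limit_weight c a z"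
  by (auto simp: limit_weight_def indicator_def zero_sum_space_def sum_negf)

lemma limit_weight_nonneg: "limit_weight c a z \<ge> 0"
  unfolding limit_weight_def by (intro mult_nonneg_nonneg prod_nonneg) auto

lemma limit_weight_pos: "z \<in> zero_sum_space \<Longrightarrow> limit_weight c a z > 0"
  unfolding limit_weight_def by (simp add: prod_pos)

text \<open>Since \<open>c i * (1 - c i) \<le> 1 / 4\<close> and \<open>a i < 1\<close>, every
  denominator is at most 1. A bound by the norm can be read in any orthonormal basis of the
  hyperplane.\<close>

lemma limit_weight_le:
  assumes c: "\<And>i. 0 < c i \<and> c i < 1" and a: "\<And>i. 0 < a i \<and> a i < 1"
  shows "limit_weight c a z \<le> exp (- (norm z)\<^sup>2)"
proof -
  have "limit_weight c a z \<le> (\<Prod>i\<in>UNIV. exp (- ((z $ i)\<^sup>2 / (2 * c i * (1 - c i) * a i))))"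
    unfolding limit_weight_def by (auto simp: indicator_def prod_nonneg)
  also have "\<dots> \<le> (\<Prod>i\<in>UNIV. exp (- (z $ i)\<^sup>2))"
  proof (intro prod_mono conjI)
    fix i
    have "c i * (1 - c i) \<le> 1 / 4"
      using zero_le_power2[of "c i - 1 / 2"] by (simp add: power2_eq_square algebra_simps)
    then have "(c i * (1 - c i)) * a i \<le> 1 / 4 * 1" using a[of i] c[of i] by (intro mult_mono) auto
    then have "2 * c i * (1 - c i) * a i \<le> 1" by simp
    moreover have "2 * c i * (1 - c i) * a i > 0" using a[of i] c[of i] by simp
    ultimately have "(z $ i)\<^sup>2 / 1 \<le> (z $ i)\<^sup>2 / (2 * c i * (1 - c i) * a i)"
      by (intro divide_left_mono) auto
    then show "exp (- ((z $ i)\<^sup>2 / (2 * c i * (1 - c i) * a i))) \<le> exp (- (z $ i)\<^sup>2)" by simp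
  qed simp
  also have "\<dots> = exp (- (norm z)\<^sup>2)"
    by (simp add: norm_vec_def L2_set_def sum_nonneg sum_negf flip: exp_sum)
  finally show ?thesis .
qed

text \<open>\<open>nu0\<close> comes with an orthonormal basis \<open>B\<close>, the lattice sums
  come with the chart; both parametrise the hyperplane, so quotients of integrals agree by
  \<open>integral_lin_comb_proportional\<close>. Integrability over \<open>B\<close> follows from
  the norm bound.\<close>

lemma limit_law_integral:
  fixes c a :: "'i::finite \<Rightarrow> real" and i0 :: 'i and g :: "real^'i \<Rightarrow> real"
  assumes c: "\<And>i. 0 < c i \<and> c i < 1" and a: "\<And>i. 0 < a i \<and> a i < 1"
    and int: "integrable (lebesgue_prod (- {i0})) (\<lambda>u. limit_weight c a (chart i0 u))"
    and g [measurable]: "g \<in> borel_measurable borel" and bounded: "bounded (range g)"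
  shows "prob_space (limit_law c a)"
    and "(\<integral>z. g z \<partial>limit_law c a) =
      (\<integral>u. limit_weight c a (chart i0 u) * g (chart i0 u) \<partial>lebesgue_prod (- {i0})) /
      (\<integral>u. limit_weight c a (chart i0 u) \<partial>lebesgue_prod (- {i0}))"
proof -
  let ?f = "limit_weight c a"
  obtain B :: "(real^'i) set" where B: "orthonormal_basis_of zero_sum_space B" "finite B"
    "nu0 = distr (lebesgue_prod B) borel (lin_comb B (\<lambda>b. b))"
    by (rule nu0_lin_comb)
  let ?T = "lin_comb B (\<lambda>b. b)"
  have range: "range ?T = zero_sum_space"
    using B by (intro range_lin_comb_basis) (auto simp: orthonormal_basis_of_def)
  have intB: "integrable (lebesgue_prod B) (\<lambda>x. ?f (?T x))"
  proof (rule Bochner_Integration.integrable_bound)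
    show "integrable (lebesgue_prod B) (\<lambda>x. \<Prod>b\<in>B. exp (- (1 * (x b)\<^sup>2)) :: real)"
      by (rule integrable_prod_gaussian) (use B in auto)
    have "norm (?f (?T x)) \<le> norm (\<Prod>b\<in>B. exp (- (1 * (x b)\<^sup>2)))" for x
      using limit_weight_le[where z = "?T x", OF c a] limit_weight_nonneg[of c a "?T x"] B(2)
      by (simp add: norm_lin_comb_orthonormal[OF B(1,2)] exp_sum sum_negf flip: exp_sum)
    then show "AE x in lebesgue_prod B. norm (?f (?T x)) \<le> norm (\<Prod>b\<in>B. exp (- (1 * (x b)\<^sup>2)))" by simp
  qed measurable
  define Z where "Z = (\<integral>z. ?f z \<partial>nu0)"
  have Z: "Z = (\<integral>x. ?f (?T x) \<partial>lebesgue_prod B)"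
    unfolding Z_def B(3) by (simp add: integral_distr)
  have Zpos: "Z > 0"
    unfolding Z using range by (intro integral_pos_lebesgue_prod B intB limit_weight_pos) auto
  have chart_pos: "(\<integral>u. ?f (chart i0 u) \<partial>lebesgue_prod (- {i0})) > 0"
    by (intro integral_pos_lebesgue_prod int limit_weight_pos chart_in_zero_sum_space) auto
  have intnu: "integrable nu0 ?f"
    unfolding B(3) using intB by (simp add: integrable_distr_eq)
  have setsnu [measurable_cong]: "sets nu0 = sets borel" by (simp add: nu0_def)
  have "(\<integral>\<^sup>+z. ennreal (?f z / Z) \<partial>nu0) = ennreal (\<integral>z. ?f z / Z \<partial>nu0)"
    using intnu Zpos by (intro nn_integral_eq_integral) (auto simp: limit_weight_nonneg)
  also have "\<dots> = 1" using Zpos by (simp add: Z_def)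
  finally have "emeasure (limit_law c a) (space (limit_law c a)) = 1"
    unfolding limit_law_def Z_def[symmetric] by (subst emeasure_density) (auto cong: nn_integral_cong)
  then show "prob_space (limit_law c a)" by (rule prob_spaceI)
  have "(\<integral>z. g z \<partial>limit_law c a) = (\<integral>z. ?f z / Z * g z \<partial>nu0)"
    unfolding limit_law_def Z_def[symmetric] using Zpos limit_weight_nonneg[of c a]
    by (subst integral_density) auto
  also have "\<dots> = (\<integral>x. ?f (?T x) * g (?T x) \<partial>lebesgue_prod B) / Z"
    unfolding B(3) by (subst integral_distr) auto
  also have "\<dots> = (\<integral>u. ?f (chart i0 u) * g (chart i0 u) \<partial>lebesgue_prod (- {i0})) /
      (\<integral>u. ?f (chart i0 u) \<partial>lebesgue_prod (- {i0}))"
  proof -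
    have "(\<integral>x. ?f (?T x) * g (?T x) \<partial>lebesgue_prod B) * (\<integral>u. ?f (chart i0 u) \<partial>lebesgue_prod (- {i0}))
       = Z * (\<integral>u. ?f (chart i0 u) * g (chart i0 u) \<partial>lebesgue_prod (- {i0}))"
      unfolding Z chart_def
      by (rule integral_lin_comb_proportional)
         (use B range range_chart[of i0] intB int bounded limit_weight_nonneg limit_weight_even in \<open>auto simp: chart_def\<close>)
    then show ?thesis using Zpos chart_pos by (simp add: field_simps)
  qed
  finally show "(\<integral>z. g z \<partial>limit_law c a) =
      (\<integral>u. limit_weight c a (chart i0 u) * g (chart i0 u) \<partial>lebesgue_prod (- {i0})) /
      (\<integral>u. limit_weight c a (chart i0 u) \<partial>lebesgue_prod (- {i0}))" .
qed

text \<open>For large n a conditional expectation is the quotient of the lattice integrals for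
  \<open>g\<close> and for the constant 1, and \<open>lattice_integral_tendsto\<close> covers both.
  The cell volume is a common factor of the two.\<close>

theorem theorem1p4:
  fixes a p :: "'i::finite \<Rightarrow> real" and \<alpha> :: real
    and m :: "nat \<Rightarrow> 'i \<Rightarrow> nat" and k :: "nat \<Rightarrow> nat"
    and \<Omega> :: "nat \<Rightarrow> 'a measure" and X :: "nat \<Rightarrow> 'i \<Rightarrow> 'a \<Rightarrow> nat"
  assumes "\<And>i. 0 < a i \<and> a i < 1" and "(\<Sum>i\<in>UNIV. a i) = 1"
    and "0 < \<alpha>" and "\<alpha> < 1"
    and "\<And>i. 0 < p i \<and> p i < 1"
    and "\<And>n. n \<ge> 1 \<Longrightarrow> (\<Sum>i\<in>UNIV. m n i) = n"
    and "\<And>i. (\<lambda>n. real (m n i) / real n) \<longlonglongrightarrow> a i"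
    and "\<And>n. n \<ge> 1 \<Longrightarrow> k n \<le> n"
    and "(\<lambda>n. real (k n) / real n) \<longlonglongrightarrow> \<alpha>"
    and "\<And>n. n \<ge> 1 \<Longrightarrow> prob_space (\<Omega> n)"
    and "\<And>n. n \<ge> 1 \<Longrightarrow> prob_space.indep_vars (\<Omega> n) (\<lambda>_. count_space UNIV) (X n) UNIV"
    and "\<And>n i. n \<ge> 1 \<Longrightarrow>
           distr (\<Omega> n) (count_space UNIV) (X n i) = measure_pmf (binomial_pmf (m n i) (p i))"
  shows "prob_space (limit_law (limit_prob p a \<alpha>) a) \<and>
         converges_weakly
           (\<lambda>n. conditional_law (\<Omega> n)
                  (normalized_vec n (m n) (tilted_prob p (m n) (k n)) (X n))
                  (\<lambda>\<omega>. (\<Sum>i\<in>UNIV. X n i \<omega>) = k n))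
           (limit_law (limit_prob p a \<alpha>) a)"
proof -
  define c where "c = limit_prob p a \<alpha>"
  define cn where "cn n = tilted_prob p (m n) (k n)" for n
  define i0 :: 'i where "i0 = undefined"
  let ?\<mu> = "\<lambda>n. conditional_law (\<Omega> n) (normalized_vec n (m n) (cn n) (X n)) (\<lambda>\<omega>. (\<Sum>i\<in>UNIV. X n i \<omega>) = k n)"
  let ?I = "\<lambda>n g. \<integral>u. lattice_weight (m n) (cn n) (lattice_point i0 n (m n) (cn n) (k n) u) *
      g (rescale n (m n) (cn n) (lattice_point i0 n (m n) (cn n) (k n) u)) \<partial>lebesgue_prod (- {i0})"
  let ?L = "\<lambda>g. \<integral>u. limit_weight c a (chart i0 u) * g (chart i0 u) \<partial>lebesgue_prod (- {i0})"
  have a: "0 < a i" for i using assms(1) by blast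
  have mn: "\<forall>n\<ge>1. (\<Sum>i\<in>UNIV. m n i) = n" using assms(6) by blast
  note tilt = tilted_prob_tendsto[where a = a and p = p and m = m and k = k and \<alpha> = \<alpha>, OF a assms(2-5) mn assms(7,9), folded cn_def c_def]
  have sum: "eventually (\<lambda>n. (\<Sum>i\<in>UNIV. cn n i * real (m n i)) = real (k n)) sequentially"
    using tilt(1) by eventually_elim (simp add: solves_tilt_system_def)
  note lim = lattice_integral_tendsto[where c = c and cn = cn and m = m and a = a and k = k, OF tilt(2,3) assms(7) a mn sum]
  have one: "continuous_on UNIV (\<lambda>_ :: real^'i. 1 :: real)" "bounded (range (\<lambda>_ :: real^'i. 1 :: real))"
    by auto
  have int: "integrable (lebesgue_prod (- {i0})) (\<lambda>u. limit_weight c a (chart i0 u))"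
    using lim(2)[OF one] by simp
  note limit = limit_law_integral[where c = c and a = a, OF tilt(3) assms(1) int]
  have pos: "?L (\<lambda>_. 1) > 0"
    using int by (simp, intro integral_pos_lebesgue_prod limit_weight_pos chart_in_zero_sum_space) auto
  have "(\<lambda>n. \<integral>z. g z \<partial>?\<mu> n) \<longlonglongrightarrow> (\<integral>z. g z \<partial>limit_law c a)"
    if g: "continuous_on UNIV g" "bounded (range g)" for g :: "real^'i \<Rightarrow> real"
  proof -
    have gm: "g \<in> borel_measurable borel" using g(1) by (rule borel_measurable_continuous_onI)
    have "(\<lambda>n. ?I n g / ?I n (\<lambda>_. 1)) \<longlonglongrightarrow> ?L g / ?L (\<lambda>_. 1)"
      using pos by (intro tendsto_divide lim(1)[OF g] lim(1)[OF one]) simp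
    also have "?L g / ?L (\<lambda>_. 1) = (\<integral>z. g z \<partial>limit_law c a)"
      using limit(2)[OF gm g(2)] by simp
    finally have "(\<lambda>n. ?I n g / ?I n (\<lambda>_. 1)) \<longlonglongrightarrow> (\<integral>z. g z \<partial>limit_law c a)" .
    \<comment> \<open>The limit of the denominators is positive, so for large n the lattice sum is
      positive as well; this gives the conditioning event positive probability.\<close>
    moreover have "eventually (\<lambda>n. ?I n g / ?I n (\<lambda>_. 1) = (\<integral>z. g z \<partial>?\<mu> n)) sequentially"
      using tilt(1) order_tendstoD(1)[OF lim(1)[OF one] pos] eventually_ge_at_top[of 1]
    proof eventually_elim
      case (elim n)
      interpret binomial_counts "\<Omega> n" "X n" "m n" p
        using assms(5,10,11,12) elim by (auto simp: binomial_counts_def binomial_counts_axioms_def)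
      have n: "n > 0" using elim by simp
      have I: "?I n G = (1 / sqrt (real n)) ^ card (- {i0}) *
          (\<Sum>x\<in>counts_with_sum (k n). lattice_weight (m n) (cn n) (\<lambda>i. int (x i)) *
            G (rescale n (m n) (cn n) (\<lambda>i. int (x i))))" for G
        by (rule integral_lattice_weight(2)[OF n])
      have "(1 / sqrt (real n)) ^ card (- {i0}) > 0" using n by simp
      moreover from this have "(\<Sum>x\<in>counts_with_sum (k n). lattice_weight (m n) (cn n) (\<lambda>i. int (x i))) > 0"
        using elim(2) unfolding I[of "\<lambda>_. 1"] by (simp add: zero_less_mult_iff)
      ultimately show ?case
        unfolding I[of g] I[of "\<lambda>_. 1"] using n conditional_law_integral[OF elim(1) gm] by simp
    qed
    ultimately show ?thesis using tendsto_cong by fast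
  qed
  then have "converges_weakly ?\<mu> (limit_law c a)"
    unfolding converges_weakly_def by blast
  then show ?thesis
    using limit(1)[OF _ one(2)] unfolding cn_def c_def by simp
qed

end
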